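(* Let $\{(i_t,j_t)\}_{t\in\mathbb{N}}$ be a sequence with $i_t,j_t\in[0,1]$ and $i_t+j_t=1$ for every $t$. Let $i=\sup_{t\in\mathbb{N}}i_t$, let $\theta\in\mathbf{Bad}(i)$, and let $\Theta=\{(\theta,y):y\in[0,1]\}$. Let $\mathbf{C}\subseteq\Theta$ be the support of a (nonzero) measure satisfying a power law. Then $$\dim\left(\mathbf{C}\cap\bigcap_{t\in\mathbb{N}}\mathbf{Bad}(i_t,j_t)\right)=\dim(\mathbf{C}).$$
   Context: $\mathbf{Bad}(i,j)$, for $i,j\in[0,1]$ with $i+j=1$: for $i,j>0$, $$\mathbf{Bad}(i,j)=\left\{(x,y)\in\mathbb{R}^2:\exists c>0\ \forall p_1,p_2\in\mathbb{Z},\ q\in\mathbb{N},\ \ \max\left\{q|qx-p_1|^{1/i},\,q|qy-p_2|^{1/j}\right\}>c\right\},$$ while $\mathbf{Bad}(1,0)=\mathbf{BA}\times\mathbb{R}$ and $\mathbf{Bad}(0,1)=\mathbb{R}\times\mathbf{BA}$, where $\mathbf{BA}$ is the classical set of badly approximable real numbers, $\{x\in\mathbb{R}:\exists c>0\ \forall p\in\mathbb{Z},q\in\mathbb{N}:\ q|qx-p|>c\}$. $\mathbf{Bad}(i)$: for $i>0$, $\mathbf{Bad}(i)=\{x\in\mathbb{R}:\exists c>0\ \forall p\in\mathbb{Z},q\in\mathbb{N}:\ q^{1/i}|qx-p|>c\}$, and $\mathbf{Bad}(0)=\mathbb{R}$. Here $\mathbb{N}=\{1,2,\dots\}$. Power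 law: a Borel measure $\mu$ on a metric space satisfies a power law if there are positive $\beta,b_1,b_2$ such that $b_1r^\beta\le\mu(B(x,r))\le b_2r^\beta$ for all $x\in\mathrm{supp}(\mu)$ and $0<r<1$. $\dim$ denotes Hausdorff dimension. *)

theory Defs
  imports "HOL-Analysis.Analysis"
begin

definition BA :: "real set" where
  "BA = {x. \<exists>c>0. \<forall>(p::int) (q::nat). q \<ge> 1 \<longrightarrow> real q * \<bar>real q * x - of_int p\<bar> > c}"

definition Bad1 :: "real \<Rightarrow> real set" where
  "Bad1 i = (if i = 0 then UNIV else
     {x. \<exists>c>0. \<forall>(p::int) (q::nat). q \<ge> 1 \<longrightarrow>
           real q powr (1 / i) * \<bar>real q * x - of_int p\<bar> > c})"

text \<open>Meaningful only for nonnegative weights with \<open>i + j = 1\<close>, so that \<open>j = 0\<close> is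
  the case \<open>(1, 0)\<close> and \<open>i = 0\<close> the case \<open>(0, 1)\<close>.\<close>

definition Bad2 :: "real \<Rightarrow> real \<Rightarrow> (real \<times> real) set" where
  "Bad2 i j =
     (if j = 0 then BA \<times> UNIV
      else if i = 0 then UNIV \<times> BA
      else {(x, y). \<exists>c>0. \<forall>(p1::int) (p2::int) (q::nat). q \<ge> 1 \<longrightarrow>
              max (real q * \<bar>real q * x - of_int p1\<bar> powr (1 / i))
                  (real q * \<bar>real q * y - of_int p2\<bar> powr (1 / j)) > c})"

definition measure_support :: "'a::topological_space measure \<Rightarrow> 'a set" where
  "measure_support M = {x. \<forall>U. open U \<longrightarrow> x \<in> U \<longrightarrow> emeasure M U > 0}"

definition power_law :: "'a::metric_space measure \<Rightarrow> bool" where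
  "power_law M \<longleftrightarrow> sets M = sets borel \<and>
     (\<exists>\<beta> b1 b2 :: real. \<beta> > 0 \<and> b1 > 0 \<and> b2 > 0 \<and>
        (\<forall>x \<in> measure_support M. \<forall>r. 0 < r \<and> r < 1 \<longrightarrow>
           ennreal (b1 * r powr \<beta>) \<le> emeasure M (ball x r) \<and>
           emeasure M (ball x r) \<le> ennreal (b2 * r powr \<beta>)))"

text \<open>The value \<open>diam(U)\<^sup>s\<close>, with the convention that it is \<open>0\<close> for empty \<open>U\<close> and that
  \<open>diam(U)\<^sup>0 = 1\<close> otherwise; the latter needs a separate case because \<open>0 powr 0 = 0\<close>.\<close>

definition diam_pow :: "real \<Rightarrow> 'a::metric_space set \<Rightarrow> ennreal" where
  "diam_pow s U = (if U = {} then 0 else if s = 0 then 1 else ennreal (diameter U powr s))"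

text \<open>Boundedness is required separately since \<open>diameter\<close> is unspecified on unbounded sets.\<close>

definition hausdorff_premeasure :: "real \<Rightarrow> real \<Rightarrow> 'a::metric_space set \<Rightarrow> ennreal" where
  "hausdorff_premeasure \<delta> s A =
     (INF U \<in> {U :: nat \<Rightarrow> 'a set. A \<subseteq> (\<Union>n. U n) \<and> (\<forall>n. bounded (U n) \<and> diameter (U n) \<le> \<delta>)}.
        \<Sum>n. diam_pow s (U n))"

definition hausdorff_measure :: "real \<Rightarrow> 'a::metric_space set \<Rightarrow> ennreal" where
  "hausdorff_measure s A = (SUP \<delta> \<in> {0<..}. hausdorff_premeasure \<delta> s A)"

definition hausdorff_dim :: "'a::metric_space set \<Rightarrow> ennreal" where
  "hausdorff_dim A = Inf {ennreal s | s :: real. s \<ge> 0 \<and> hausdorff_measure s A = 0}"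

end

theory Submission
  imports Defs
begin

text \<open>
Fix a point \<open>(\<theta>, y)\<close> of the fibre. If it is not badly approximable for positive weights \<open>(i, j)\<close>,
then for every \<open>c\<close> some rational point \<open>(p/q, r/q)\<close> satisfies \<open>q\<^sup>i |q \<theta> - p| \<le> c\<^sup>i\<close> and
\<open>q\<^sup>j |q y - r| \<le> c\<^sup>j\<close>. By the pigeonhole principle there is an integral line \<open>A p + B r + C q = 0\<close>
through it with \<open>|A| \<le> q\<^sup>i\<close> and \<open>|B| \<le> q\<^sup>j\<close>, and \<open>\<theta> \<in> Bad(i)\<close> forces \<open>B \<noteq> 0\<close>. Hence the line crosses
the fibre, and \<open>y\<close> lies within \<open>(c\<^sup>i + c\<^sup>j) / (q B)\<close> of the crossing point. It therefore suffices to avoid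
these neighbourhoods of crossing points, for one suitable \<open>c\<close> per pair of weights.

The neighbourhoods are few. They are sorted by the power \<open>T = R\<^sup>m\<close> of a base \<open>R\<close> just below \<open>q\<close> and
by a level \<open>n\<close>. The level is chosen so that \<open>R\<^sup>-\<^sup>n\<close> is a constant times \<open>1 / (T B)\<close>, enlarged by a small power of
\<open>T\<^sup>j / B\<close>. In a ball of radius \<open>R\<^sup>-\<^sup>n\<close> that is not already contained in a neighbourhood of lower level,
all lines with the same \<open>m\<close> and \<open>n\<close> cross the fibre at the same point (\<open>crossing_unique\<close>). There are two
regimes. If \<open>T\<^sup>j / B\<close> is bounded, evaluating one line at the rational point of another gives an integer of
absolute value less than one, so each of two lines contains both points. If \<open>T\<^sup>j / B\<close> is large, two
different lines would meet in a rational point of such small height that it approximates every point of the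
ball; its own neighbourhood would contain the ball and would have lower level. Because of the enlargement,
the radii of the neighbourhoods of level \<open>n\<close> decay geometrically in \<open>m\<close>, so the sum of their \<open>s\<close>-th
powers is a small multiple of \<open>R\<^sup>-\<^sup>n\<^sup>s\<close>. Such a family of balls is called thin below.

A thin family cannot exhaust the support of a measure with a power law of exponent \<open>\<beta> > s\<close>
(\<open>exists_point_avoiding_thin_family\<close>): one descends through balls of radius \<open>R\<^sup>-\<^sup>n\<close> centred in the support
and keeps the sum of \<open>r\<^sup>s\<close> over the relevant balls small by averaging over the measure. Countably many thin
families whose bounds sum up form a thin family again, which handles all weights at once. The dimension
comes for free: if the \<open>s\<close>-dimensional Hausdorff measure of the intersection were zero for some
\<open>s < \<beta>\<close>, it would be covered by balls that themselves form a thin family. Adding these to the others and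
avoiding all of them gives a point that is in the intersection and outside its cover. The converse bound
\<open>dim C \<le> \<beta>\<close> is a packing estimate.
\<close>

section \<open>Hausdorff measure and supports\<close>

lemma hausdorff_measure_mono:
  assumes "A \<subseteq> B"
  shows "hausdorff_measure s A \<le> hausdorff_measure s B"
  unfolding hausdorff_measure_def hausdorff_premeasure_def
  by (intro SUP_mono' INF_superset_mono) (use assms in auto)

lemma hausdorff_dim_mono:
  assumes "A \<subseteq> B"
  shows "hausdorff_dim A \<le> hausdorff_dim B"
  unfolding hausdorff_dim_def
proof (intro Inf_superset_mono subsetI)
  fix t assume "t \<in> {ennreal s |s. 0 \<le> s \<and> hausdorff_measure s B = 0}"
  then obtain s where s: "t = ennreal s" "0 \<le> s" "hausdorff_measure s B = 0" by auto
  have "hausdorff_measure s A = 0"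
    using hausdorff_measure_mono[OF assms, of s] s(3) by simp
  then show "t \<in> {ennreal s |s. 0 \<le> s \<and> hausdorff_measure s A = 0}" using s by auto
qed

text \<open>
The radii must be positive, since only balls of positive radius can be avoided by the descent argument
below. A summable positive term is therefore added to each diameter, and the passage from \<open>s\<close> to a larger
\<open>s'\<close> makes the convention for \<open>diam\<^sup>0\<close> harmless.
\<close>

lemma hausdorff_null_ball_cover:
  fixes E :: "'a::metric_space set"
  assumes null: "hausdorff_measure s E = 0" and "0 \<le> s" "s < s'" "0 < \<eta>"
  obtains z :: "nat \<Rightarrow> 'a" and r :: "nat \<Rightarrow> real"
  where "\<And>n. 0 < r n" "E \<subseteq> (\<Union>n. cball (z n) (r n))"
    "(\<Sum>n. ennreal (r n powr s')) \<le> ennreal \<eta>"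
proof -
  have s': "s' > 0" using assms by linarith
  define \<kappa> where "\<kappa> = \<eta> / (2 * 2 powr s')"
  have \<kappa>: "\<kappa> > 0" using assms by (simp add: \<kappa>_def)
  have "hausdorff_premeasure 1 s E \<le> hausdorff_measure s E"
    unfolding hausdorff_measure_def by (rule SUP_upper) auto
  then have "hausdorff_premeasure 1 s E < ennreal \<kappa>"
    using null \<kappa> by simp
  then obtain U where U: "E \<subseteq> (\<Union>n. U n)" "\<And>n. bounded (U n) \<and> diameter (U n) \<le> 1"
    and sumU: "(\<Sum>n. diam_pow s (U n)) < ennreal \<kappa>"
    unfolding hausdorff_premeasure_def INF_less_iff by auto
  define d where "d n = (if U n = {} then 0 else diameter (U n))" for n
  define e where "e n = (\<kappa> * (1/2) ^ Suc n) powr (1 / s')" for n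
  define r where "r n = d n + e n" for n
  define z where "z n = (SOME x. U n \<noteq> {} \<longrightarrow> x \<in> U n)" for n
  have z: "z n \<in> U n" if "U n \<noteq> {}" for n
    unfolding z_def using that by (metis (mono_tags, lifting) ex_in_conv someI_ex)
  have d0: "0 \<le> d n" "d n \<le> 1" for n
    using U(2)[of n] by (auto simp: d_def diameter_ge_0)
  have e0: "0 < e n" for n using \<kappa> by (simp add: e_def)
  have e_pow: "e n powr s' = \<kappa> * (1/2) ^ Suc n" for n
    using \<kappa> s' by (simp add: e_def powr_powr)
  have d_pow: "ennreal (d n powr s') \<le> diam_pow s (U n)" for n
  proof (cases "U n = {} \<or> d n = 0")
    case True
    then have "d n = 0" by (auto simp: d_def split: if_splits)
    then show ?thesis using s' by simp
  next
    case False
    then have "0 < d n" "d n = diameter (U n)"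
      using d0[of n] by (auto simp: d_def less_eq_real_def split: if_splits)
    moreover have "d n powr s' \<le> d n powr s"
      using \<open>0 < d n\<close> d0[of n] assms by (intro powr_mono') auto
    ultimately show ?thesis
      using False by (auto simp: diam_pow_def intro!: ennreal_leI)
  qed
  have r_pow: "ennreal (r n powr s') \<le> ennreal (2 powr s') * (diam_pow s (U n) + ennreal (\<kappa> * (1/2) ^ Suc n))" for n
  proof -
    have "r n powr s' \<le> (2 * max (d n) (e n)) powr s'"
      using d0 e0[of n] s' by (intro powr_mono2) (auto simp: r_def)
    also have "\<dots> = 2 powr s' * max (d n) (e n) powr s'"
      by (rule powr_mult)
    also have "\<dots> \<le> 2 powr s' * (d n powr s' + e n powr s')"
      by (intro mult_left_mono) (auto simp: max_def)
    finally have "ennreal (r n powr s') \<le> ennreal (2 powr s' * (d n powr s' + e n powr s'))"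
      by (rule ennreal_leI)
    also have "\<dots> = ennreal (2 powr s') * (ennreal (d n powr s') + ennreal (\<kappa> * (1/2) ^ Suc n))"
      using \<kappa> by (simp add: ennreal_mult ennreal_plus e_pow)
    also have "\<dots> \<le> ennreal (2 powr s') * (diam_pow s (U n) + ennreal (\<kappa> * (1/2) ^ Suc n))"
      by (intro mult_left_mono add_right_mono d_pow) auto
    finally show ?thesis .
  qed
  have geo: "(\<Sum>n. ennreal (\<kappa> * (1/2) ^ Suc n)) = ennreal \<kappa>"
  proof (rule suminf_ennreal_eq)
    show "(\<lambda>n. \<kappa> * (1/2) ^ Suc n) sums \<kappa>"
      using sums_mult[OF power_half_series, of \<kappa>] by simp
  qed (use \<kappa> in auto)
  show ?thesis
  proof (rule that[of r z])
    show "0 < r n" for n using d0(1)[of n] e0[of n] by (simp add: r_def)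
    show "E \<subseteq> (\<Union>n. cball (z n) (r n))"
    proof
      fix x assume "x \<in> E"
      then obtain n where n: "x \<in> U n" using U(1) by auto
      then have "dist (z n) x \<le> d n"
        using U(2)[of n] z[of n] by (auto simp: d_def intro: diameter_bounded_bound)
      then have "x \<in> cball (z n) (r n)" using e0[of n] by (auto simp: r_def)
      then show "x \<in> (\<Union>n. cball (z n) (r n))" by blast
    qed
    have "(\<Sum>n. ennreal (r n powr s'))
        \<le> (\<Sum>n. ennreal (2 powr s') * (diam_pow s (U n) + ennreal (\<kappa> * (1/2) ^ Suc n)))"
      by (intro suminf_le r_pow) auto
    also have "\<dots> = ennreal (2 powr s') * ((\<Sum>n. diam_pow s (U n)) + ennreal \<kappa>)"
      unfolding geo[symmetric] by (subst suminf_add) (auto intro: ennreal_suminf_cmult)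
    also have "\<dots> \<le> ennreal (2 powr s') * (ennreal \<kappa> + ennreal \<kappa>)"
      using sumU by (intro mult_left_mono add_right_mono) auto
    also have "\<dots> = ennreal \<eta>"
      using \<kappa> by (simp flip: ennreal_mult ennreal_plus) (simp add: \<kappa>_def)
    finally show "(\<Sum>n. ennreal (r n powr s')) \<le> ennreal \<eta>" .
  qed
qed

lemma closed_measure_support:
  "closed (measure_support M)"
proof -
  have "- measure_support M = \<Union>{U. open U \<and> emeasure M U = 0}"
    by (auto simp: measure_support_def zero_less_iff_neq_zero)
  then have "open (- measure_support M)" by auto
  then show ?thesis by (simp add: closed_def)
qed

lemma emeasure_compl_measure_support:
  fixes M :: "'a::second_countable_topology measure"
  assumes "sets M = sets borel"
  shows "emeasure M (- measure_support M) = 0"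
proof -
  define \<U> where "\<U> = {U :: 'a set. open U \<and> emeasure M U = 0}"
  have eq: "- measure_support M = \<Union>\<U>"
    by (auto simp: measure_support_def zero_less_iff_neq_zero \<U>_def)
  have op: "\<And>S. S \<in> \<U> \<Longrightarrow> open S" by (auto simp: \<U>_def)
  obtain \<V> where V: "\<V> \<subseteq> \<U>" "countable \<V>" "\<Union>\<V> = \<Union>\<U>"
    using Lindelof[OF op] by metis
  have "(\<Union>V\<in>\<V>. V) \<in> null_sets M"
    using V assms by (intro null_sets_UN') (auto simp: \<U>_def null_sets_def)
  then show ?thesis using V eq by auto
qed

text \<open>
A maximal \<open>r\<close>-separated subset of \<open>C\<close> has at most of the order of \<open>r\<^sup>-\<^sup>\<beta>\<close> points, because the
balls of radius \<open>r/2\<close> about them are disjoint and each has measure at least of the order of \<open>r\<^sup>\<beta>\<close>. The balls of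
radius \<open>r\<close> about its points cover \<open>C\<close>.
\<close>

lemma power_law_upper_dimension:
  fixes M :: "'a::metric_space measure"
  assumes sets: "sets M = sets borel" and fin: "emeasure M UNIV < \<infinity>"
    and "0 < b" "0 < \<beta>" "\<beta> < s"
    and lower: "\<And>x r. x \<in> C \<Longrightarrow> 0 < r \<Longrightarrow> r < 1 \<Longrightarrow> ennreal (b * r powr \<beta>) \<le> emeasure M (ball x r)"
  shows "hausdorff_measure s C = 0"
proof -
  define V where "V = measure M UNIV"
  have V: "emeasure M UNIV = ennreal V" "V \<ge> 0"
    using fin by (auto simp: V_def emeasure_eq_ennreal_measure less_top)
  define K where "K = V * 2 powr \<beta> / b"
  have packing: "real (card S) \<le> K * r powr - \<beta>"
    if S: "S \<subseteq> C" "finite S" "\<And>x y. x \<in> S \<Longrightarrow> y \<in> S \<Longrightarrow> x \<noteq> y \<Longrightarrow> r \<le> dist x y"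
      and r: "0 < r" "r < 1" for S r
  proof -
    have disj: "disjoint_family_on (\<lambda>x. ball x (r/2)) S"
      unfolding disjoint_family_on_def
    proof (intro ballI impI)
      fix x y assume "x \<in> S" "y \<in> S" "x \<noteq> y"
      from S(3)[OF this] show "ball x (r/2) \<inter> ball y (r/2) = {}"
        by (intro disjoint_ballI) auto
    qed
    have "ennreal (real (card S) * (b * (r/2) powr \<beta>)) = (\<Sum>x\<in>S. ennreal (b * (r/2) powr \<beta>))"
      using \<open>0 < b\<close> by (simp add: ennreal_mult ennreal_of_nat_eq_real_of_nat)
    also have "\<dots> \<le> (\<Sum>x\<in>S. emeasure M (ball x (r/2)))"
      using S r by (intro sum_mono lower) auto
    also have "\<dots> = emeasure M (\<Union>x\<in>S. ball x (r/2))"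
      using S disj sets by (intro sum_emeasure) auto
    also have "\<dots> \<le> emeasure M UNIV"
      by (intro emeasure_mono) (use sets sets_eq_imp_space_eq[OF sets] in auto)
    finally have "real (card S) * (b * (r/2) powr \<beta>) \<le> V"
      using V by simp
    then have "real (card S) * (b * (r powr \<beta> / 2 powr \<beta>)) \<le> V"
      using r by (simp add: powr_divide)
    then show ?thesis
      using \<open>0 < b\<close> r by (simp add: K_def powr_minus field_simps)
  qed
  have bound: "hausdorff_premeasure \<delta> s C \<le> ennreal (K * 2 powr s * r powr (s - \<beta>))"
    if r: "0 < r" "r < 1" "2 * r \<le> \<delta>" for r \<delta>
  proof -
    define P where "P S \<longleftrightarrow> S \<subseteq> C \<and> finite S \<and> (\<forall>x\<in>S. \<forall>y\<in>S. x \<noteq> y \<longrightarrow> r \<le> dist x y)" for S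
    define N where "N = nat \<lceil>K * r powr - \<beta>\<rceil>"
    have cardN: "card S \<le> N" if "P S" for S
    proof -
      have "real (card S) \<le> K * r powr - \<beta>"
        using that r by (intro packing) (auto simp: P_def)
      then show ?thesis by (simp add: N_def) linarith
    qed
    have "\<exists>S. P S \<and> (\<forall>S'. P S' \<longrightarrow> card S' \<le> card S)"
    proof -
      have "P {}" by (simp add: P_def)
      then show ?thesis
        using ex_has_greatest_nat[of P "{}" card "Suc N"] cardN by (metis less_Suc_eq_le)
    qed
    then obtain S where S: "P S" "\<And>S'. P S' \<Longrightarrow> card S' \<le> card S" by blast
    have finS: "finite S" using S by (simp add: P_def)
    have cover: "\<exists>x\<in>S. dist x y < r" if "y \<in> C" for y
    proof (rule ccontr)
      assume neg: "\<not> ?thesis"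
      then have "y \<notin> S" using r by force
      have "P (insert y S)"
        using S(1) neg that by (auto simp: P_def dist_commute not_less)
      from S(2)[OF this] \<open>y \<notin> S\<close> finS show False by simp
    qed
    obtain f where f: "bij_betw f {..<card S} S"
      using finS ex_bij_betw_nat_finite[of S] by (auto simp: atLeast0LessThan)
    define U where "U n = (if n < card S then ball (f n) r else {})" for n
    have diam: "diameter (ball x r) \<le> 2 * r" for x :: 'a
    proof (cases "ball x r = {}")
      case False
      have "dist u v \<le> 2 * r" if "u \<in> ball x r" "v \<in> ball x r" for u v
        using that dist_triangle2[of u v x] by (auto simp: dist_commute)
      then have "(SUP (u, v)\<in>ball x r \<times> ball x r. dist u v) \<le> 2 * r"
        using False by (intro cSUP_least) auto
      then show ?thesis using False by (simp add: diameter_def)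
    qed (use r in auto)
    have "hausdorff_premeasure \<delta> s C \<le> (\<Sum>n. diam_pow s (U n))"
      unfolding hausdorff_premeasure_def
    proof (rule INF_lower, clarify, intro conjI allI)
      show "C \<subseteq> (\<Union>n. U n)"
      proof
        fix y assume "y \<in> C"
        then obtain x where "x \<in> S" "dist x y < r" using cover by blast
        moreover obtain n where "n < card S" "x = f n"
          using f \<open>x \<in> S\<close> by (auto simp: bij_betw_def)
        ultimately have "y \<in> U n" by (simp add: U_def)
        then show "y \<in> (\<Union>n. U n)" by blast
      qed
      show "bounded (U n)" for n by (simp add: U_def)
      show "diameter (U n) \<le> \<delta>" for n
        using diam[of "f n"] r by (auto simp: U_def)
    qed
    also have "\<dots> \<le> (\<Sum>n. if n < card S then ennreal ((2 * r) powr s) else 0)"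
    proof (intro suminf_le)
      fix n
      have "diameter (ball (f n) r) powr s \<le> (2 * r) powr s"
        using diam[of "f n"] assms by (intro powr_mono2) (auto intro: diameter_ge_0)
      then show "diam_pow s (U n) \<le> (if n < card S then ennreal ((2 * r) powr s) else 0)"
        using assms by (auto simp: diam_pow_def U_def intro!: ennreal_leI)
    qed auto
    also have "\<dots> = (\<Sum>n<card S. ennreal ((2 * r) powr s))"
      by (subst suminf_finite[of "{..<card S}"]) auto
    also have "\<dots> = ennreal (real (card S) * (2 * r) powr s)"
      by (simp add: ennreal_mult ennreal_of_nat_eq_real_of_nat)
    also have "\<dots> \<le> ennreal (K * r powr - \<beta> * (2 * r) powr s)"
    proof (intro ennreal_leI mult_right_mono)
      show "real (card S) \<le> K * r powr - \<beta>"
        using S(1) r by (intro packing) (auto simp: P_def)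
    qed auto
    also have "K * r powr - \<beta> * (2 * r) powr s = K * 2 powr s * r powr (s - \<beta>)"
      using r by (simp add: powr_mult powr_diff powr_minus field_simps)
    finally show ?thesis .
  qed
  have "hausdorff_premeasure \<delta> s C \<le> 0" if "\<delta> > 0" for \<delta>
  proof (rule tendsto_lowerbound)
    have "((\<lambda>r. r powr (s - \<beta>)) \<longlongrightarrow> 0) (at_right 0)"
      using assms by (intro tendsto_zero_powrI[of _ _ _ "s - \<beta>"])
        (auto intro: tendsto_eq_intros eventually_at_right_less simp: eventually_at_filter)
    then have "((\<lambda>r. ennreal (K * 2 powr s * r powr (s - \<beta>))) \<longlongrightarrow> ennreal (K * 2 powr s * 0)) (at_right 0)"
      by (intro tendsto_ennrealI tendsto_mult_left)
    then show "((\<lambda>r. ennreal (K * 2 powr s * r powr (s - \<beta>))) \<longlongrightarrow> 0) (at_right 0)"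
      by simp
    show "\<forall>\<^sub>F r in at_right 0. hausdorff_premeasure \<delta> s C \<le> ennreal (K * 2 powr s * r powr (s - \<beta>))"
      unfolding eventually_at_right_field
    proof (intro exI conjI allI impI)
      show "0 < min 1 (\<delta> / 2)" using that by simp
    qed (use bound in auto)
  qed simp
  then show ?thesis
    unfolding hausdorff_measure_def by (auto simp: SUP_eq_iff intro!: SUP_eqI)
qed

section \<open>Thin families of balls\<close>

text \<open>
An element \<open>(z, r, l)\<close> stands for a ball to be avoided, taken into account from the scale \<open>R\<^sup>-\<^sup>l\<close> on.
The bound is required only for balls \<open>cball x (R\<^sup>-\<^sup>n)\<close> that are not visibly contained in a ball of
lower level. This restriction is essential for the arithmetic application, where crowding of the balls of
one level is excluded by producing a ball of lower level that contains all of them.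
\<close>

definition thin_family :: "'a::metric_space set \<Rightarrow> real \<Rightarrow> real \<Rightarrow> real \<Rightarrow> ('a \<times> real \<times> nat) set \<Rightarrow> bool"
  where
  "thin_family L R s \<eta> F \<longleftrightarrow> countable F \<and> (\<forall>(z, r, l)\<in>F. 0 < r) \<and>
     (\<forall>n. \<forall>x\<in>L.
        (\<forall>(z, r, l)\<in>F. l < n \<longrightarrow> r < dist z x + (1 / R) ^ n) \<longrightarrow>
        (\<integral>\<^sup>+(z, r, l). ennreal (r powr s)
            \<partial>count_space {(z, r, l)\<in>F. l = n \<and> dist z x \<le> r + (1 / R) ^ n})
          \<le> ennreal (\<eta> * ((1 / R) ^ n) powr s))"

lemma nn_integral_count_space_UN_le:
  fixes f :: "'a \<Rightarrow> ennreal"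
  shows "(\<integral>\<^sup>+x. f x \<partial>count_space (\<Union>t::nat. A t)) \<le> (\<Sum>t. \<integral>\<^sup>+x. f x \<partial>count_space (A t))"
proof -
  have "(\<integral>\<^sup>+x. f x \<partial>count_space (\<Union>t. A t)) = (\<integral>\<^sup>+x. f x * indicator (\<Union>t. A t) x \<partial>count_space UNIV)"
    by (rule nn_integral_count_space_indicator) auto
  also have "\<dots> \<le> (\<integral>\<^sup>+x. (\<Sum>t. f x * indicator (A t) x) \<partial>count_space UNIV)"
  proof (intro nn_integral_mono)
    fix x
    show "f x * indicator (\<Union>t. A t) x \<le> (\<Sum>t. f x * indicator (A t) x)"
    proof (cases "x \<in> (\<Union>t. A t)")
      case True
      then obtain t where "x \<in> A t" by auto
      then have "f x * indicator (\<Union>t. A t) x = (\<Sum>u\<in>{t}. f x * indicator (A u) x)"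
        using True by simp
      also have "\<dots> \<le> (\<Sum>t. f x * indicator (A t) x)"
        by (intro sum_le_suminf) auto
      finally show ?thesis .
    qed simp
  qed
  also have "\<dots> = (\<Sum>t. \<integral>\<^sup>+x. f x * indicator (A t) x \<partial>count_space UNIV)"
    by (rule nn_integral_suminf) auto
  also have "\<dots> = (\<Sum>t. \<integral>\<^sup>+x. f x \<partial>count_space (A t))"
    by (intro suminf_cong nn_integral_count_space_indicator[symmetric]) auto
  finally show ?thesis .
qed

lemma nn_integral_count_space_mono_set:
  fixes f :: "'a \<Rightarrow> ennreal"
  assumes "A \<subseteq> B"
  shows "(\<integral>\<^sup>+x. f x \<partial>count_space A) \<le> (\<integral>\<^sup>+x. f x \<partial>count_space B)"
proof -
  have "(\<integral>\<^sup>+x. f x \<partial>count_space A) = (\<integral>\<^sup>+x. f x * indicator A x \<partial>count_space UNIV)"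
    "(\<integral>\<^sup>+x. f x \<partial>count_space B) = (\<integral>\<^sup>+x. f x * indicator B x \<partial>count_space UNIV)"
    by (rule nn_integral_count_space_indicator, simp)+
  then show ?thesis
    using assms by (auto intro!: nn_integral_mono split: split_indicator)
qed

lemma nn_integral_count_space_Un_disjoint:
  fixes f :: "'a \<Rightarrow> ennreal"
  assumes "A \<inter> B = {}"
  shows "(\<integral>\<^sup>+x. f x \<partial>count_space (A \<union> B)) = (\<integral>\<^sup>+x. f x \<partial>count_space A) + (\<integral>\<^sup>+x. f x \<partial>count_space B)"
proof -
  have eq: "(\<integral>\<^sup>+x. f x \<partial>count_space S) = (\<integral>\<^sup>+x. f x * indicator S x \<partial>count_space UNIV)" for S
    by (rule nn_integral_count_space_indicator) auto
  have "(\<integral>\<^sup>+x. f x * indicator (A \<union> B) x \<partial>count_space UNIV)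
      = (\<integral>\<^sup>+x. f x * indicator A x + f x * indicator B x \<partial>count_space UNIV)"
    using assms by (intro nn_integral_cong) (auto split: split_indicator)
  also have "\<dots> = (\<integral>\<^sup>+x. f x * indicator A x \<partial>count_space UNIV) + (\<integral>\<^sup>+x. f x * indicator B x \<partial>count_space UNIV)"
    by (rule nn_integral_add) auto
  finally show ?thesis by (simp only: eq)
qed

lemma nn_integral_count_space_upper:
  fixes f :: "'a \<Rightarrow> ennreal"
  assumes "x \<in> A"
  shows "f x \<le> (\<integral>\<^sup>+x. f x \<partial>count_space A)"
proof -
  have "f x = (\<integral>\<^sup>+x. f x \<partial>count_space {x})" by (simp add: nn_integral_count_space_finite)
  also have "\<dots> \<le> (\<integral>\<^sup>+x. f x \<partial>count_space A)"
    by (rule nn_integral_count_space_mono_set) (use assms in auto)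
  finally show ?thesis .
qed

lemma thin_family_UN:
  fixes F :: "nat \<Rightarrow> ('a::metric_space \<times> real \<times> nat) set"
  assumes thin: "\<And>t. thin_family L R s (\<eta> * (1/2) ^ Suc t) (F t)" and "0 \<le> \<eta>"
  shows "thin_family L R s \<eta> (\<Union>t. F t)"
  unfolding thin_family_def
proof (intro conjI allI ballI impI)
  show "countable (\<Union>t. F t)"
    using thin by (auto simp: thin_family_def)
  show "case p of (z, r, l) \<Rightarrow> 0 < r" if "p \<in> (\<Union>t. F t)" for p
    using thin that by (fastforce simp: thin_family_def)
  fix n x
  assume x: "x \<in> L"
    and prem: "\<forall>(z, r, l)\<in>\<Union>t. F t. l < n \<longrightarrow> r < dist z x + (1 / R) ^ n"
  define e where "e = ((1 / R) ^ n) powr s"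
  define S where "S t = {(z, r, l)\<in>F t. l = n \<and> dist z x \<le> r + (1 / R) ^ n}" for t
  have "(\<integral>\<^sup>+(z, r, l). ennreal (r powr s) \<partial>count_space (S t)) \<le> ennreal (\<eta> * (1/2) ^ Suc t * e)" for t
    using thin[of t] x prem unfolding thin_family_def S_def e_def by blast
  then have "(\<Sum>t. \<integral>\<^sup>+(z, r, l). ennreal (r powr s) \<partial>count_space (S t)) \<le> (\<Sum>t. ennreal (\<eta> * (1/2) ^ Suc t * e))"
    by (intro suminf_le) auto
  also have "\<dots> = ennreal (\<eta> * e)"
  proof (rule suminf_ennreal_eq)
    show "(\<lambda>t. \<eta> * (1/2) ^ Suc t * e) sums (\<eta> * e)"
      using sums_mult[OF power_half_series, of "\<eta> * e"] by (simp add: mult_ac)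
  qed (use \<open>0 \<le> \<eta>\<close> in \<open>auto simp: e_def\<close>)
  finally have "(\<integral>\<^sup>+(z, r, l). ennreal (r powr s) \<partial>count_space (\<Union>t. S t)) \<le> ennreal (\<eta> * e)"
    by (rule order_trans[OF nn_integral_count_space_UN_le])
  moreover have "(\<Union>t. S t) = {(z, r, l)\<in>\<Union>t. F t. l = n \<and> dist z x \<le> r + (1 / R) ^ n}"
    by (auto simp: S_def)
  ultimately show "(\<integral>\<^sup>+(z, r, l). ennreal (r powr s)
       \<partial>count_space {(z, r, l)\<in>\<Union>t. F t. l = n \<and> dist z x \<le> r + (1 / R) ^ n})
       \<le> ennreal (\<eta> * ((1 / R) ^ n) powr s)"
    by (simp add: e_def)
qed

text \<open>
Covers of small total size enter the descent in this form, so that a cover of the set under study is avoided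
together with everything else.
\<close>

lemma thin_family_level_zero:
  fixes z :: "nat \<Rightarrow> 'a::metric_space"
  assumes "\<And>n. 0 < r n" "(\<Sum>n. ennreal (r n powr s)) \<le> ennreal \<eta>"
  shows "thin_family L R s \<eta> (range (\<lambda>n. (z n, r n, 0)))"
  unfolding thin_family_def
proof (intro conjI allI ballI impI)
  fix n x
  define S where "S = {(w, q, l) \<in> range (\<lambda>n. (z n, r n, 0)). l = n \<and> dist w x \<le> q + (1 / R) ^ n}"
  have "(\<integral>\<^sup>+(w, q, l). ennreal (q powr s) \<partial>count_space S) \<le> ennreal (\<eta> * ((1 / R) ^ n) powr s)"
  proof (cases "n = 0")
    case True
    have "(\<integral>\<^sup>+(w, q, l). ennreal (q powr s) \<partial>count_space S)
        \<le> (\<integral>\<^sup>+(w, q, l). ennreal (q powr s) \<partial>count_space (\<Union>m. {(z m, r m, 0::nat)}))"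
      by (rule nn_integral_count_space_mono_set) (auto simp: S_def)
    also have "\<dots> \<le> (\<Sum>m. \<integral>\<^sup>+(w, q, l). ennreal (q powr s) \<partial>count_space {(z m, r m, 0::nat)})"
      by (rule nn_integral_count_space_UN_le)
    also have "\<dots> = (\<Sum>m. ennreal (r m powr s))"
      by (simp add: nn_integral_count_space_finite)
    finally show ?thesis using assms(2) True by simp
  next
    case False
    then have "S = {}" by (auto simp: S_def)
    then show ?thesis by (simp add: nn_integral_empty)
  qed
  then show "(\<integral>\<^sup>+(w, q, l). ennreal (q powr s)
       \<partial>count_space {(w, q, l) \<in> range (\<lambda>n. (z n, r n, 0)). l = n \<and> dist w x \<le> q + (1 / R) ^ n})
       \<le> ennreal (\<eta> * ((1 / R) ^ n) powr s)"
    by (simp add: S_def)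
qed (use assms in auto)

text \<open>
The potential of a ball of radius \<open>R\<^sup>-\<^sup>n\<close> is the sum of \<open>r\<^sup>s\<close> over the family members of level at most \<open>n\<close>
that meet it. Shrinking the radius by the factor \<open>R\<close> leaves, on average over the new centre, only a
proportion of order \<open>R\<^sup>-\<^sup>\<beta>\<close> of the potential, while the admissible size \<open>R\<^sup>-\<^sup>n\<^sup>s\<close> shrinks by \<open>R\<^sup>-\<^sup>s\<close> only.
As \<open>s < \<beta>\<close>, this leaves room for the members of the next level. A limit point that lay in a member of
radius \<open>r\<close> would force all potentials from some level on to be at least \<open>r\<^sup>s\<close>, although they tend to zero.
\<close>

lemma exists_point_avoiding_thin_family:
  fixes M :: "'a::{complete_space, second_countable_topology} measure"
  assumes sets: "sets M = sets borel" and "closed C" and "C \<noteq> {}" and "C \<subseteq> L"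
    and null: "emeasure M (- C) = 0"
    and b: "0 < b1" "0 < b2" and s: "0 < s" "0 < \<beta>"
    and lower: "\<And>x r. x \<in> C \<Longrightarrow> 0 < r \<Longrightarrow> r < 1 \<Longrightarrow> ennreal (b1 * r powr \<beta>) \<le> emeasure M (ball x r)"
    and upper: "\<And>x r. x \<in> C \<Longrightarrow> 0 < r \<Longrightarrow> r < 1 \<Longrightarrow> emeasure M (ball x r) \<le> ennreal (b2 * r powr \<beta>)"
    and R: "6 \<le> R" "2 * 10 powr \<beta> * b2 < b1 * R powr (\<beta> - s)"
    and \<eta>: "0 < \<eta>" "2 * \<eta> \<le> R powr - s"
    and thin: "thin_family L R s \<eta> F"
  shows "\<exists>x\<in>C. \<forall>(z, r, l)\<in>F. r < dist z x"
proof -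
  define \<rho> where "\<rho> n = (1 / R) ^ n" for n :: nat
  have \<rho>0: "0 < \<rho> n" "\<rho> n \<le> 1" for n
    using R by (auto simp: \<rho>_def power_le_one)
  have \<rho>S: "\<rho> (Suc n) = \<rho> n / R" for n by (simp add: \<rho>_def)
  have \<rho>S6: "\<rho> (Suc n) \<le> \<rho> n / 6" for n
    unfolding \<rho>S using R \<rho>0(1)[of n] by (intro divide_left_mono) auto
  have cF: "countable F" and rF: "\<And>z r l. (z, r, l) \<in> F \<Longrightarrow> 0 < r"
    using thin by (auto simp: thin_family_def)
  define I where "I n x = {(z, r, l)\<in>F. l \<le> n \<and> dist z x \<le> r + \<rho> n}" for n x
  define J where "J n x = {(z, r, l)\<in>F. l \<le> n \<and> dist z x \<le> r + \<rho> (Suc n)}" for n x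
  define N where "N n x = {(z, r, l)\<in>F. l = n \<and> dist z x \<le> r + \<rho> n}" for n x
  define w :: "'a \<times> real \<times> nat \<Rightarrow> ennreal" where "w = (\<lambda>(z, r, l). ennreal (r powr s))"
  have new: "(\<integral>\<^sup>+p. w p \<partial>count_space (N n x)) \<le> ennreal (\<eta> * \<rho> n powr s)"
    if "x \<in> C" "\<And>z r l. (z, r, l) \<in> F \<Longrightarrow> l < n \<Longrightarrow> r < dist z x + \<rho> n" for n x
  proof -
    have "x \<in> L" using that \<open>C \<subseteq> L\<close> by auto
    moreover have "\<forall>(z, r, l)\<in>F. l < n \<longrightarrow> r < dist z x + (1 / R) ^ n"
      using that(2) by (auto simp: \<rho>_def)
    ultimately show ?thesis
      using thin unfolding thin_family_def N_def \<rho>_def w_def by blast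
  qed
  define good where "good n x \<longleftrightarrow> x \<in> C \<and> (\<integral>\<^sup>+p. w p \<partial>count_space (I n x)) \<le> ennreal (2 * \<eta> * \<rho> n powr s)" for n x
  have base: "\<exists>x. good 0 x"
  proof -
    obtain x where x: "x \<in> C" using \<open>C \<noteq> {}\<close> by auto
    have "I 0 x = N 0 x" by (auto simp: I_def N_def)
    moreover have "(\<integral>\<^sup>+p. w p \<partial>count_space (N 0 x)) \<le> ennreal (\<eta> * \<rho> 0 powr s)"
      by (rule new[OF x]) auto
    moreover have "ennreal (\<eta> * \<rho> 0 powr s) \<le> ennreal (2 * \<eta> * \<rho> 0 powr s)"
      using \<eta> by (intro ennreal_leI mult_right_mono) auto
    ultimately show ?thesis using x unfolding good_def by (metis order_trans)
  qed
  have step: "\<exists>y. good (Suc n) y \<and> dist x y \<le> \<rho> n / 2" if gx: "good n x" for n x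
  proof -
    have x: "x \<in> C" and pot: "(\<integral>\<^sup>+p. w p \<partial>count_space (I n x)) \<le> ennreal (2 * \<eta> * \<rho> n powr s)"
      using gx by (auto simp: good_def)
    define B where "B = ball x (\<rho> n / 2)"
    have Bm: "B \<in> sets M" using sets by (simp add: B_def)
    \<comment> \<open>A single member cannot be larger than the next scale, as its own contribution would exceed the potential.\<close>
    have small: "r \<le> \<rho> (Suc n)" if "(z, r, l) \<in> I n x" for z r l
    proof -
      have "ennreal (r powr s) \<le> ennreal (2 * \<eta> * \<rho> n powr s)"
        using nn_integral_count_space_upper[OF that, of w] pot by (simp add: w_def)
      then have "r powr s \<le> 2 * \<eta> * \<rho> n powr s"
        using \<eta> by simp
      also have "\<dots> \<le> R powr - s * \<rho> n powr s"
        using \<eta> by (intro mult_right_mono) auto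
      also have "\<dots> = \<rho> (Suc n) powr s"
        using R \<rho>0(1)[of n] by (simp add: \<rho>S powr_divide powr_minus field_simps)
      finally have le: "r powr s \<le> \<rho> (Suc n) powr s" .
      show ?thesis
      proof (rule ccontr)
        assume "\<not> ?thesis"
        then have "\<rho> (Suc n) powr s < r powr s"
          using \<rho>0(1)[of "Suc n"] s by (intro powr_less_mono2) auto
        with le show False by simp
      qed
    qed
    have meets: "p \<in> I n x" if "y \<in> B" "p \<in> J n y" for y p
    proof -
      obtain z r l where p: "p = (z, r, l)" by (cases p)
      have "dist z x \<le> dist z y + dist x y" by (metis dist_commute dist_triangle)
      also have "\<dots> \<le> r + \<rho> (Suc n) + \<rho> n / 2"
        using that p by (auto simp: J_def B_def)
      also have "\<dots> \<le> r + \<rho> n" using \<rho>S6[of n] \<rho>0(1)[of n] by simp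
      finally show ?thesis using that p by (auto simp: J_def I_def)
    qed
    define V where "V p = B \<inter> {y. p \<in> J n y}" for p
    have Vm: "V p \<in> sets M" for p
    proof -
      obtain z r l where p: "p = (z, r, l)" by (cases p)
      have "{y. p \<in> J n y} = (if (z, r, l) \<in> F \<and> l \<le> n then cball z (r + \<rho> (Suc n)) else {})"
        by (auto simp: J_def p)
      then show ?thesis using sets Bm by (auto simp: V_def)
    qed
    have Vle: "emeasure M (V p) \<le> ennreal (b2 * (5 * \<rho> (Suc n)) powr \<beta>)" if "p \<in> I n x" for p
    proof (cases "V p \<inter> C = {}")
      case True
      then have "emeasure M (V p) \<le> emeasure M (- C)"
        using \<open>closed C\<close> sets by (intro emeasure_mono) auto
      then show ?thesis using null by simp
    next
      case False
      then obtain y where y: "y \<in> V p" "y \<in> C" by auto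
      obtain z r l where p: "p = (z, r, l)" by (cases p)
      have r: "r \<le> \<rho> (Suc n)" using small that p by auto
      have "V p \<subseteq> ball y (5 * \<rho> (Suc n))"
      proof
        fix y' assume "y' \<in> V p"
        then have "dist z y' \<le> 2 * \<rho> (Suc n)" "dist z y \<le> 2 * \<rho> (Suc n)"
          using y p r by (auto simp: V_def J_def)
        then have "dist y y' \<le> 4 * \<rho> (Suc n)"
          using dist_triangle3[of y y' z] by simp
        then show "y' \<in> ball y (5 * \<rho> (Suc n))" using \<rho>0(1)[of "Suc n"] by simp
      qed
      then have "emeasure M (V p) \<le> emeasure M (ball y (5 * \<rho> (Suc n)))"
        using sets by (intro emeasure_mono) auto
      also have "\<dots> \<le> ennreal (b2 * (5 * \<rho> (Suc n)) powr \<beta>)"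
        using y \<rho>0[of n] \<rho>0(1)[of "Suc n"] \<rho>S6[of n] by (intro upper) auto
      finally show ?thesis .
    qed
    \<comment> \<open>Averaging: a member occupies a set of measure of order at most \<open>R\<^sup>-\<^sup>\<beta>\<close> relative to \<open>B\<close>.\<close>
    have "\<exists>y\<in>B \<inter> C. (\<integral>\<^sup>+p. w p \<partial>count_space (J n y)) \<le> ennreal (\<eta> * \<rho> (Suc n) powr s)"
    proof (rule ccontr)
      assume "\<not> ?thesis"
      then have big: "ennreal (\<eta> * \<rho> (Suc n) powr s) \<le> (\<integral>\<^sup>+p. w p \<partial>count_space (J n y))"
        if "y \<in> B" "y \<in> C" for y
        using that by (meson IntI linear)
      define e where "e = \<eta> * \<rho> (Suc n) powr s"
      have "ennreal e * ennreal (b1 * (\<rho> n / 2) powr \<beta>) \<le> ennreal e * emeasure M B"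
        unfolding B_def using x \<rho>0[of n] by (intro mult_left_mono lower) auto
      also have "\<dots> = (\<integral>\<^sup>+y. ennreal e * indicator B y \<partial>M)"
        using Bm by (simp add: nn_integral_cmult_indicator)
      also have "\<dots> \<le> (\<integral>\<^sup>+y. (\<integral>\<^sup>+p. w p * indicator (V p) y \<partial>count_space F) \<partial>M)"
      proof (rule nn_integral_mono_AE)
        have "AE y in M. y \<in> C"
          by (rule AE_I[of _ _ "- C"]) (use null \<open>closed C\<close> sets in auto)
        then show "AE y in M. ennreal e * indicator B y \<le> (\<integral>\<^sup>+p. w p * indicator (V p) y \<partial>count_space F)"
        proof eventually_elim
          case (elim y)
          show ?case
          proof (cases "y \<in> B")
            case True
            have "(\<integral>\<^sup>+p. w p \<partial>count_space (J n y)) = (\<integral>\<^sup>+p. w p * indicator (J n y) p \<partial>count_space UNIV)"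
              by (rule nn_integral_count_space_indicator) auto
            also have "\<dots> = (\<integral>\<^sup>+p. w p * indicator (V p) y * indicator F p \<partial>count_space UNIV)"
              using True by (intro nn_integral_cong) (auto simp: V_def J_def split: split_indicator)
            also have "\<dots> = (\<integral>\<^sup>+p. w p * indicator (V p) y \<partial>count_space F)"
              by (rule nn_integral_count_space_indicator[symmetric]) auto
            finally show ?thesis using big[OF True elim] True by (simp add: e_def)
          qed simp
        qed
      qed
      also have "\<dots> = (\<integral>\<^sup>+p. (\<integral>\<^sup>+y. w p * indicator (V p) y \<partial>M) \<partial>count_space F)"
        using cF Vm by (intro nn_integral_count_space_nn_integral) auto
      also have "\<dots> = (\<integral>\<^sup>+p. w p * emeasure M (V p) \<partial>count_space F)"
        using Vm by (intro nn_integral_cong) (simp add: nn_integral_cmult_indicator)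
      also have "\<dots> \<le> (\<integral>\<^sup>+p. w p * ennreal (b2 * (5 * \<rho> (Suc n)) powr \<beta>) * indicator (I n x) p \<partial>count_space F)"
      proof (intro nn_integral_mono)
        fix p assume "p \<in> space (count_space F)"
        show "w p * emeasure M (V p) \<le> w p * ennreal (b2 * (5 * \<rho> (Suc n)) powr \<beta>) * indicator (I n x) p"
        proof (cases "p \<in> I n x")
          case True
          then show ?thesis using Vle[OF True] by (simp add: mult_left_mono)
        next
          case False
          then have "V p = {}" using meets[of _ p] by (auto simp: V_def)
          then show ?thesis by simp
        qed
      qed
      also have "\<dots> = (\<integral>\<^sup>+p. w p * ennreal (b2 * (5 * \<rho> (Suc n)) powr \<beta>) \<partial>count_space (I n x))"
      proof -
        have eq: "(\<integral>\<^sup>+p. f p \<partial>count_space S) = (\<integral>\<^sup>+p. f p * indicator S p \<partial>count_space UNIV)"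
          for f :: "_ \<Rightarrow> ennreal" and S :: "('a \<times> real \<times> nat) set"
          by (rule nn_integral_count_space_indicator) auto
        have "I n x \<subseteq> F" by (auto simp: I_def)
        then show ?thesis
          unfolding eq[where S = F] eq[where S = "I n x"]
          by (intro nn_integral_cong) (auto split: split_indicator)
      qed
      also have "\<dots> = (\<integral>\<^sup>+p. w p \<partial>count_space (I n x)) * ennreal (b2 * (5 * \<rho> (Suc n)) powr \<beta>)"
        by (rule nn_integral_multc) auto
      also have "\<dots> \<le> ennreal (2 * \<eta> * \<rho> n powr s) * ennreal (b2 * (5 * \<rho> (Suc n)) powr \<beta>)"
        by (intro mult_right_mono pot) auto
      finally have ineq: "e * (b1 * (\<rho> n / 2) powr \<beta>) \<le> 2 * \<eta> * \<rho> n powr s * (b2 * (5 * \<rho> (Suc n)) powr \<beta>)"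
        using b \<eta> by (simp add: e_def flip: ennreal_mult)
      have inv: "(1 / R) powr t = R powr - t" for t
        by (simp add: powr_divide powr_minus_divide)
      have half: "(\<rho> n / 2) powr \<beta> = \<rho> n powr \<beta> * (1/2) powr \<beta>"
        using powr_mult[of "\<rho> n" "1/2" \<beta>] by simp
      have shrink: "\<rho> (Suc n) powr t = \<rho> n powr t * R powr - t" for t
        using powr_mult[of "\<rho> n" "1/R" t] by (simp add: \<rho>S inv)
      have five: "(5 * \<rho> (Suc n)) powr \<beta> = 5 powr \<beta> * (\<rho> n powr \<beta> * R powr - \<beta>)"
        by (simp only: powr_mult shrink)
      from ineq have "\<eta> * (\<rho> n powr s * \<rho> n powr \<beta>) * (b1 * R powr - s * (1/2) powr \<beta>)
          \<le> \<eta> * (\<rho> n powr s * \<rho> n powr \<beta>) * (2 * b2 * 5 powr \<beta> * R powr - \<beta>)"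
        unfolding e_def half five shrink by (simp only: mult_ac)
      then have "b1 * R powr - s * (1/2) powr \<beta> \<le> 2 * b2 * 5 powr \<beta> * R powr - \<beta>"
        using \<eta> \<rho>0(1)[of n] by simp
      then have "(b1 * R powr - s * (1/2) powr \<beta>) * (R powr \<beta> * 2 powr \<beta>)
          \<le> (2 * b2 * 5 powr \<beta> * R powr - \<beta>) * (R powr \<beta> * 2 powr \<beta>)"
        by (rule mult_right_mono) simp
      also have "(2 * b2 * 5 powr \<beta> * R powr - \<beta>) * (R powr \<beta> * 2 powr \<beta>)
          = 2 * b2 * (5 * 2) powr \<beta> * (R powr (- \<beta> + \<beta>))"
        unfolding powr_mult powr_add by (simp only: mult_ac)
      also have "(b1 * R powr - s * (1/2) powr \<beta>) * (R powr \<beta> * 2 powr \<beta>)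
          = b1 * (R powr (\<beta> + - s)) * ((1/2) * 2) powr \<beta>"
        unfolding powr_mult powr_add by (simp only: mult_ac)
      finally have "b1 * R powr (\<beta> - s) \<le> 2 * b2 * 10 powr \<beta>"
        using R by simp
      with R show False by (simp add: mult_ac)
    qed
    then obtain y where y: "y \<in> B" "y \<in> C"
      and old: "(\<integral>\<^sup>+p. w p \<partial>count_space (J n y)) \<le> ennreal (\<eta> * \<rho> (Suc n) powr s)" by auto
    have "(\<integral>\<^sup>+p. w p \<partial>count_space (N (Suc n) y)) \<le> ennreal (\<eta> * \<rho> (Suc n) powr s)"
    proof (rule new[OF y(2)], rule ccontr)
      fix z r l assume F: "(z, r, l) \<in> F" "l < Suc n" "\<not> r < dist z y + \<rho> (Suc n)"
      then have mem: "(z, r, l) \<in> J n y" using \<rho>0(1)[of "Suc n"] by (auto simp: J_def)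
      have "ennreal (r powr s) \<le> ennreal (\<eta> * \<rho> (Suc n) powr s)"
        using nn_integral_count_space_upper[OF mem, of w] old by (simp add: w_def)
      then have "r powr s \<le> \<eta> * \<rho> (Suc n) powr s"
        using \<eta> by simp
      moreover have "\<eta> < 1"
      proof -
        have "R powr - s \<le> 1" using R s by (simp add: powr_le_one_le powr_minus ge_one_powr_ge_zero inverse_le_1_iff)
        then show ?thesis using \<eta> by linarith
      qed
      moreover have "\<rho> (Suc n) powr s \<le> r powr s"
        using F \<rho>0(1)[of "Suc n"] s zero_le_dist[of z y] by (intro powr_mono2) linarith+
      moreover have "\<rho> (Suc n) powr s > 0" using \<rho>0(1)[of "Suc n"] by simp
      ultimately show False
        using mult_strict_right_mono[of \<eta> 1 "\<rho> (Suc n) powr s"] by linarith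
    qed
    moreover have "I (Suc n) y = J n y \<union> N (Suc n) y" "J n y \<inter> N (Suc n) y = {}"
      by (auto simp: I_def J_def N_def le_Suc_eq)
    then have "(\<integral>\<^sup>+p. w p \<partial>count_space (I (Suc n) y))
        = (\<integral>\<^sup>+p. w p \<partial>count_space (J n y)) + (\<integral>\<^sup>+p. w p \<partial>count_space (N (Suc n) y))"
      by (simp add: nn_integral_count_space_Un_disjoint)
    ultimately have "(\<integral>\<^sup>+p. w p \<partial>count_space (I (Suc n) y))
        \<le> ennreal (\<eta> * \<rho> (Suc n) powr s) + ennreal (\<eta> * \<rho> (Suc n) powr s)"
      using old by (simp add: add_mono)
    also have "\<dots> = ennreal (2 * \<eta> * \<rho> (Suc n) powr s)"
      using \<eta> by (simp flip: ennreal_plus)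
    finally have "good (Suc n) y" using y by (simp add: good_def)
    then show ?thesis using y(1) by (auto simp: B_def)
  qed
  obtain x where x: "\<And>n. good n (x n)" "\<And>n. dist (x n) (x (Suc n)) \<le> \<rho> n / 2"
    using dependent_nat_choice[of good "\<lambda>n x y. dist x y \<le> \<rho> n / 2", OF base step] by metis
  have near: "dist (x n) (x (n + k)) \<le> \<rho> n - \<rho> (n + k)" for n k
  proof (induction k)
    case (Suc k)
    have "dist (x n) (x (n + Suc k)) \<le> dist (x n) (x (n + k)) + dist (x (n + k)) (x (Suc (n + k)))"
      using dist_triangle[of "x n" "x (n + Suc k)" "x (n + k)"] by simp
    also have "\<dots> \<le> \<rho> n - \<rho> (n + k) + \<rho> (n + k) / 2"
      using Suc x(2)[of "n + k"] by simp
    also have "\<dots> \<le> \<rho> n - \<rho> (n + Suc k)"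
      using \<rho>S6[of "n + k"] \<rho>0(1)[of "n + k"] by simp
    finally show ?case .
  qed simp
  have \<rho>lim: "\<rho> \<longlonglongrightarrow> 0"
    unfolding \<rho>_def using R by (intro LIMSEQ_power_zero) auto
  have "Cauchy x"
  proof (rule metric_CauchyI)
    fix e :: real assume "0 < e"
    then obtain n where n: "\<rho> n < e / 2"
      using order_tendstoD(2)[OF \<rho>lim, of "e / 2"] by (auto simp: eventually_sequentially)
    have close: "dist (x n) (x m) < e / 2" if "m \<ge> n" for m
      using near[of n "m - n"] n \<rho>0(1)[of m] that by simp
    show "\<exists>n. \<forall>m\<ge>n. \<forall>m'\<ge>n. dist (x m) (x m') < e"
      using close dist_triangle_half_r[of "x n"] by (metis)
  qed
  then obtain a where a: "x \<longlonglongrightarrow> a"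
    using Cauchy_convergent convergent_def by blast
  have aC: "a \<in> C"
    using closed_sequentially[OF \<open>closed C\<close> _ a] x(1) by (auto simp: good_def)
  have dist_a: "dist (x n) a \<le> \<rho> n" for n
  proof (rule LIMSEQ_le_const2)
    show "(\<lambda>m. dist (x n) (x m)) \<longlonglongrightarrow> dist (x n) a" by (intro tendsto_intros a)
    have "dist (x n) (x m) \<le> \<rho> n" if "m \<ge> n" for m
      using near[of n "m - n"] that \<rho>0(1)[of m] by simp
    then show "\<exists>N. \<forall>m\<ge>N. dist (x n) (x m) \<le> \<rho> n" by blast
  qed
  have "r < dist z a" if F: "(z, r, l) \<in> F" for z r l
  proof (rule ccontr)
    assume "\<not> r < dist z a"
    have le: "r powr s \<le> 2 * \<eta> * \<rho> n powr s" if "n \<ge> l" for n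
    proof -
      have "dist z (x n) \<le> dist z a + dist (x n) a" by (metis dist_commute dist_triangle)
      then have "(z, r, l) \<in> I n (x n)"
        using F that \<open>\<not> r < dist z a\<close> dist_a[of n] by (auto simp: I_def)
      then have "ennreal (r powr s) \<le> (\<integral>\<^sup>+p. w p \<partial>count_space (I n (x n)))"
        using nn_integral_count_space_upper[of _ _ w] by (fastforce simp: w_def)
      also have "\<dots> \<le> ennreal (2 * \<eta> * \<rho> n powr s)"
        using x(1)[of n] by (simp add: good_def)
      finally show ?thesis using \<eta> by simp
    qed
    have "(\<lambda>n. \<rho> n powr s) \<longlonglongrightarrow> 0"
      using \<rho>0 s by (intro tendsto_zero_powrI[OF \<rho>lim tendsto_const]) (auto simp: less_imp_le)
    then have "(\<lambda>n. 2 * \<eta> * \<rho> n powr s) \<longlonglongrightarrow> 2 * \<eta> * 0"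
      by (intro tendsto_mult_left)
    then have "r powr s \<le> 2 * \<eta> * 0"
      using le by (intro LIMSEQ_le_const) blast+
    then show False using rF[OF F] by simp
  qed
  then show ?thesis using aC by auto
qed

section \<open>Integral points and lines\<close>

lemma exists_small_relation:
  fixes p r q :: int and a b :: real
  assumes "1 \<le> q" "0 \<le> a" "0 \<le> b" "a * b = of_int q"
  shows "\<exists>A B C :: int. (A \<noteq> 0 \<or> B \<noteq> 0) \<and> \<bar>of_int A\<bar> \<le> a \<and> \<bar>of_int B\<bar> \<le> b \<and> A * p + B * r + C * q = 0"
proof -
  define S where "S = {0..\<lfloor>a\<rfloor>} \<times> {0..\<lfloor>b\<rfloor>}"
  define f where "f = (\<lambda>(A, B). (A * p + B * r) mod q)"
  have "a * b < of_int (\<lfloor>a\<rfloor> + 1) * of_int (\<lfloor>b\<rfloor> + 1)"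
    using assms by (intro mult_strict_mono') linarith+
  then have "real_of_int q < of_int ((\<lfloor>a\<rfloor> + 1) * (\<lfloor>b\<rfloor> + 1))"
    unfolding assms(4) of_int_mult .
  then have "q < (\<lfloor>a\<rfloor> + 1) * (\<lfloor>b\<rfloor> + 1)"
    unfolding of_int_less_iff .
  then have "nat q < nat ((\<lfloor>a\<rfloor> + 1) * (\<lfloor>b\<rfloor> + 1))" using assms(1) by simp
  also have "\<dots> = card S"
    using assms by (simp add: S_def card_cartesian_product nat_mult_distrib)
  finally have "nat q < card S" .
  moreover have "card (f ` S) \<le> nat q"
  proof -
    have "f ` S \<subseteq> {0..<q}" using assms(1) by (auto simp: f_def)
    then have "card (f ` S) \<le> card {0..<q}" by (intro card_mono) auto
    then show ?thesis by simp
  qed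
  ultimately have "\<not> inj_on f S" using pigeonhole[of f S] by simp
  then obtain A1 B1 A2 B2 where AB: "(A1, B1) \<in> S" "(A2, B2) \<in> S" "(A1, B1) \<noteq> (A2, B2)"
    and eq: "f (A1, B1) = f (A2, B2)"
    by (auto simp: inj_on_def)
  have "q dvd (A1 * p + B1 * r) - (A2 * p + B2 * r)"
    using eq by (simp add: f_def mod_eq_dvd_iff)
  then obtain D where D: "(A1 * p + B1 * r) - (A2 * p + B2 * r) = q * D" by auto
  show ?thesis
  proof (intro exI conjI)
    show "A1 - A2 \<noteq> 0 \<or> B1 - B2 \<noteq> 0" using AB by auto
    show "(A1 - A2) * p + (B1 - B2) * r + (- D) * q = 0" using D by (simp add: algebra_simps)
    have "\<bar>A1 - A2\<bar> \<le> \<lfloor>a\<rfloor>" "\<bar>B1 - B2\<bar> \<le> \<lfloor>b\<rfloor>" using AB by (auto simp: S_def)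
    then show "\<bar>of_int (A1 - A2)\<bar> \<le> a" "\<bar>of_int (B1 - B2)\<bar> \<le> b"
      unfolding of_int_abs[symmetric] le_floor_iff[symmetric] .
  qed
qed

text \<open>
A vertical line \<open>A x + C = 0\<close> through the point would make \<open>- C / A\<close> a rational approximation of \<open>\<theta>\<close>
with denominator at most \<open>q\<^sup>i\<close>, and better than \<open>\<theta> \<in> Bad(i)\<close> permits.
\<close>

lemma exists_nonvertical_line:
  fixes p r q :: int and \<theta> :: real
  assumes "0 < i" "0 < j" "i + j = 1"
    and \<theta>: "\<And>(p::int) (q::nat). 1 \<le> q \<Longrightarrow> \<kappa> < real q powr (1 / i) * \<bar>real q * \<theta> - of_int p\<bar>"
    and "1 \<le> q" and near: "of_int q powr i * \<bar>of_int q * \<theta> - of_int p\<bar> \<le> \<kappa>"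
  shows "\<exists>A B C :: int. 1 \<le> B \<and> \<bar>of_int A\<bar> \<le> of_int q powr i \<and> of_int B \<le> of_int q powr j
    \<and> A * p + B * r + C * q = 0"
proof -
  have q: "0 < real_of_int q" using \<open>1 \<le> q\<close> by simp
  have "of_int q powr i * of_int q powr j = (of_int q :: real)"
    using q assms(3) by (simp flip: powr_add)
  then obtain A B C :: int where ne: "A \<noteq> 0 \<or> B \<noteq> 0"
    and A: "\<bar>of_int A\<bar> \<le> of_int q powr i" and B: "\<bar>of_int B\<bar> \<le> of_int q powr j"
    and rel: "A * p + B * r + C * q = 0"
    using exists_small_relation[OF \<open>1 \<le> q\<close>, of "of_int q powr i" "of_int q powr j" p r] by auto
  have "B \<noteq> 0"
  proof
    assume "B = 0"
    then have "A \<noteq> 0" using ne by simp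
    define a where "a = nat \<bar>A\<bar>"
    have a: "1 \<le> a" "real a = \<bar>of_int A\<bar>" using \<open>A \<noteq> 0\<close> by (auto simp: a_def)
    have C: "real_of_int C * of_int q = - of_int A * of_int p"
    proof -
      have "C * q = - A * p" using rel \<open>B = 0\<close> by simp
      then have "real_of_int (C * q) = of_int (- A * p)" by (rule arg_cong)
      then show ?thesis by simp
    qed
    have "of_int q * (of_int A * \<theta> + of_int C) = of_int A * (of_int q * \<theta> - of_int p)"
      using C by (simp add: algebra_simps)
    then have "of_int q * \<bar>of_int A * \<theta> + of_int C\<bar> = \<bar>of_int A\<bar> * \<bar>of_int q * \<theta> - of_int p\<bar>"
      using q by (metis abs_mult abs_of_pos)
    also have "\<dots> \<le> of_int q powr i * \<bar>of_int q * \<theta> - of_int p\<bar>"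
      using A by (intro mult_right_mono) auto
    also have "\<dots> \<le> \<kappa>" by (rule near)
    finally have small: "of_int q * \<bar>of_int A * \<theta> + of_int C\<bar> \<le> \<kappa>" .
    have "real a powr (1 / i) \<le> (of_int q powr i) powr (1 / i)"
      using A a assms by (intro powr_mono2) auto
    then have "real a powr (1 / i) \<le> of_int q"
      using assms q by (simp add: powr_powr)
    then have le: "real a powr (1 / i) * \<bar>of_int A * \<theta> + of_int C\<bar> \<le> \<kappa>"
      using small by (meson abs_ge_zero mult_right_mono order_trans)
    have eq: "\<bar>of_int A * \<theta> + of_int C\<bar> = \<bar>real a * \<theta> - of_int (- sgn A * C)\<bar>"
    proof (cases "A > 0")
      case False
      then have "real a * \<theta> - of_int (- sgn A * C) = - (of_int A * \<theta> + of_int C)"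
        using a \<open>A \<noteq> 0\<close> by simp
      then show ?thesis by (simp only: abs_minus_cancel)
    qed (use a in simp)
    have "\<kappa> < real a powr (1 / i) * \<bar>of_int A * \<theta> + of_int C\<bar>"
      unfolding eq by (rule \<theta>[OF a(1)])
    with le show False by simp
  qed
  show ?thesis
  proof (cases "B > 0")
    case True
    then show ?thesis using A B rel by (intro exI[of _ A] exI[of _ B] exI[of _ C]) auto
  next
    case False
    have "- A * p + - B * r + - C * q = 0" using rel by simp
    then show ?thesis
      using False A B \<open>B \<noteq> 0\<close>
      by (intro exI[of _ "- A"] exI[of _ "- B"] exI[of _ "- C"]) auto
  qed
qed

lemma primitive_reduction:
  fixes p r q :: int
  assumes "1 \<le> q"
  obtains g p' r' q' :: int where "1 \<le> g" "p = g * p'" "r = g * r'" "q = g * q'" "1 \<le> q'"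
    "gcd p' (gcd r' q') = 1"
proof -
  define g where "g = gcd p (gcd r q)"
  have g0: "0 < g"
    using assms by (simp add: g_def)
  have "g dvd p" "g dvd r" "g dvd q"
    unfolding g_def by (auto intro: dvd_trans[OF gcd_dvd2])
  then obtain p' r' q' where e: "p = g * p'" "r = g * r'" "q = g * q'" by (auto elim!: dvdE)
  have "g = g * gcd p' (gcd r' q')"
  proof -
    have "g = gcd (g * p') (gcd (g * r') (g * q'))" using g_def e by simp
    also have "\<dots> = g * gcd p' (gcd r' q')" using g0 by (simp add: gcd_mult_left)
    finally show ?thesis .
  qed
  then have "gcd p' (gcd r' q') = 1" using g0 by simp
  moreover have "1 \<le> q'" using assms e(3) g0 by (simp add: zero_less_mult_iff int_one_le_iff_zero_less)
  ultimately show ?thesis using that[of g p' r' q'] e g0 by simp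
qed

lemma primitive_proportional_eq:
  fixes p1 r1 q1 p2 r2 q2 :: int
  assumes "gcd p1 (gcd r1 q1) = 1" "gcd p2 (gcd r2 q2) = 1" "1 \<le> q1" "1 \<le> q2"
    and "p1 * q2 = p2 * q1" "r1 * q2 = r2 * q1"
  shows "p1 = p2 \<and> r1 = r2 \<and> q1 = q2"
proof -
  have dvd: "q dvd q'" if "gcd p (gcd r q) = 1" "1 \<le> q'" "p * q' = p' * q" "r * q' = r' * q" for p r q p' r' q' :: int
  proof -
    have "q dvd gcd (q' * p) (gcd (q' * r) (q' * q))"
      using that by (intro gcd_greatest) (simp_all add: mult.commute[of q'])
    also have "\<dots> = q' * gcd p (gcd r q)"
      using that by (simp add: gcd_mult_left)
    finally show ?thesis using that by simp
  qed
  have "q1 dvd q2" by (rule dvd[OF assms(1,4,5,6)])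
  moreover have "q2 dvd q1" by (rule dvd[OF assms(2,3) assms(5,6)[symmetric]])
  ultimately have "q1 = q2" using assms(3,4) by (intro zdvd_antisym_nonneg) auto
  then show ?thesis using assms(3,5,6) by simp
qed

lemma exists_power_bracket:
  fixes R x :: real
  assumes "1 < R" "1 \<le> x"
  shows "\<exists>n. R ^ n \<le> x \<and> x < R ^ Suc n"
proof -
  define n where "n = nat \<lfloor>log R x\<rfloor>"
  have "0 \<le> log R x" using assms by simp
  then have "real n \<le> log R x" "log R x < real (Suc n)" by (auto simp: n_def) linarith+
  then have "R powr real n \<le> x" "x < R powr real (Suc n)"
    using assms by (auto simp: le_log_iff log_less_iff)
  then show ?thesis using assms by (metis powr_realpow order_less_trans zero_less_one)
qed

text \<open>
Only indices with \<open>b \<le> G m\<close> contribute; from the first of them on, the terms decrease at least geometrically.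
\<close>

lemma geometric_tail_sum_le:
  fixes G :: "nat \<Rightarrow> real"
  assumes "1 < R" "0 < a" "0 < b" "\<And>m. 0 < G m" "\<And>m. R * G m \<le> G (Suc m)"
  shows "(\<Sum>m. ennreal (if b \<le> G m then G m powr - a else 0)) \<le> ennreal (b powr - a / (1 - R powr - a))"
proof -
  define f where "f m = (if b \<le> G m then G m powr - a else 0)" for m
  define t where "t = R powr - a"
  have t: "0 < t" "t < 1" using assms by (auto simp: t_def powr_less_one)
  have grow: "R ^ k * G m \<le> G (m + k)" for m k
  proof (induction k)
    case (Suc k)
    have "R ^ Suc k * G m \<le> R * G (m + k)" using Suc assms(1) by simp
    also have "\<dots> \<le> G (m + Suc k)" using assms(5)[of "m + k"] by simp
    finally show ?case .
  qed simp
  have partial: "(\<Sum>m<N. f m) \<le> b powr - a / (1 - t)" for N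
  proof (cases "\<exists>m. b \<le> G m")
    case False
    then show ?thesis using t by (auto simp: f_def)
  next
    case True
    define m0 where "m0 = (LEAST m. b \<le> G m)"
    have m0: "b \<le> G m0" unfolding m0_def using True by (rule LeastI_ex)
    have zero: "f m = 0" if "m < m0" for m
      using not_less_Least[of m "\<lambda>m. b \<le> G m"] that by (auto simp: f_def m0_def)
    have le: "f (m0 + k) \<le> b powr - a * t ^ k" for k
    proof -
      have "R ^ k * b \<le> G (m0 + k)"
        using grow[of k m0] mult_left_mono[OF m0, of "R ^ k"] zero_le_power[of R k] assms(1)
        by linarith
      then have "G (m0 + k) powr - a \<le> (R ^ k * b) powr - a"
        using assms by (intro powr_mono2') auto
      also have "\<dots> = b powr - a * t ^ k"
        using assms by (simp add: powr_mult t_def powr_powr mult.commute flip: powr_realpow)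
      finally show ?thesis using t by (auto simp: f_def)
    qed
    have "(\<Sum>m<N. f m) \<le> (\<Sum>m<m0 + N. f m)"
      by (intro sum_mono2) (auto simp: f_def)
    also have "\<dots> = (\<Sum>m<m0. f m) + (\<Sum>k<N. f (m0 + k))"
      by (induction N) auto
    also have "\<dots> = (\<Sum>k<N. f (m0 + k))" using zero by simp
    also have "\<dots> \<le> (\<Sum>k<N. b powr - a * t ^ k)" by (intro sum_mono le)
    also have "\<dots> = b powr - a * ((1 - t ^ N) / (1 - t))"
      using t by (simp add: sum_distrib_left[symmetric] sum_gp_strict)
    also have "\<dots> \<le> b powr - a * (1 / (1 - t))"
      using t by (intro mult_left_mono divide_right_mono) auto
    finally show ?thesis by simp
  qed
  show ?thesis
  proof (rule suminf_le_const)
    show "(\<Sum>m<N. ennreal (if b \<le> G m then G m powr - a else 0)) \<le> ennreal (b powr - a / (1 - R powr - a))" for N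
      using partial[of N] by (subst sum_ennreal) (auto simp: f_def t_def intro!: ennreal_leI)
  qed simp
qed

section \<open>Lines crossing the fibre\<close>

text \<open>
The constants are tied together as follows. The number \<open>c\<close> measures approximability, \<open>\<zeta>\<close> is the ratio
between the scale of a level and the natural length \<open>1 / (T B)\<close> before enlargement, and \<open>\<nu>\<close> is the exponent of
the enlargement. The threshold \<open>G0\<close> separates the regime where \<open>\<zeta>\<close> alone makes the argument work from the
one where \<open>G0\<close> does. The neighbourhoods have size proportional to \<open>c\<^sup>i + c\<^sup>j\<close>, and \<open>small_radius\<close> makes them
small in comparison with \<open>\<zeta>\<close>. These requirements pull in opposite directions: a small \<open>c\<close> forces a
large \<open>G0\<close>, and this forces a small \<open>\<zeta>\<close>. They are compatible because a small \<open>\<nu>\<close> makes \<open>\<zeta>\<close> a small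
power of \<open>c\<close>.
\<close>

locale weighted_lines =
  fixes i j \<theta> R c \<zeta> \<nu> G0 \<kappa> :: real
  assumes weights: "0 < i" "0 < j" "i + j = 1"
    and theta: "\<And>(p::int) (q::nat). 1 \<le> q \<Longrightarrow> \<kappa> < real q powr (1 / i) * \<bar>real q * \<theta> - of_int p\<bar>"
    and R: "2 \<le> R" and c: "0 < c" "c powr i \<le> \<kappa>" and \<zeta>: "0 < \<zeta>" "\<zeta> \<le> 1"
    and \<nu>: "0 < \<nu>" "\<nu> \<le> 1 / 2" and G0: "1 \<le> G0"
    and small_radius: "(c powr i + c powr j) * R\<^sup>2 \<le> \<zeta>"
    and near_regime: "2 * R * c powr i + 4 * R ^ 3 * \<zeta> * G0 powr \<nu> < 1"
    and far_regime: "\<And>G. G0 \<le> G \<Longrightarrow> 8 * R ^ 4 * G powr (2 * \<nu> - 1) \<le> c powr i"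
      "\<And>G. G0 \<le> G \<Longrightarrow> 12 * R ^ 4 * G powr (\<nu> + (\<nu> - 1) * j) \<le> c powr j"
begin

definition \<epsilon> where "\<epsilon> = c powr i + c powr j"

definition T :: "nat \<Rightarrow> real" where "T m = R ^ m"

text \<open>
A line chosen for a point with denominator about \<open>T\<close> has natural length scale \<open>1 / (T B)\<close>, which is at least
\<open>1 / T\<^bsup>1+j\<^esup>\<close> up to a constant. The quantity \<open>G m n\<close> compares \<open>T\<^bsup>1+j\<^esup>\<close> with \<open>\<zeta> R\<^sup>n\<close>, and \<open>Z m n\<close> is the
geometric mean of the two with weights \<open>\<nu>\<close> and \<open>1 - \<nu>\<close>. A line has level \<open>n\<close> if \<open>T B\<close> lies between \<open>Z m n\<close>
and \<open>Z m (n + 1)\<close>. Up to constants, \<open>T\<^sup>j / B\<close> is then a power of \<open>G m n\<close>.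
\<close>

definition G :: "nat \<Rightarrow> nat \<Rightarrow> real" where "G m n = T m powr (1 + j) / (\<zeta> * R ^ n)"

definition Z :: "nat \<Rightarrow> nat \<Rightarrow> real" where "Z m n = \<zeta> * R ^ n * G m n powr \<nu>"

text \<open>
Coprimality makes a rational point determine its three integers, so that \<open>line_through\<close> chooses one line per
rational point.
\<close>

definition near_point :: "int \<Rightarrow> int \<Rightarrow> int \<Rightarrow> bool" where
  "near_point p r q \<longleftrightarrow> 1 \<le> q \<and> gcd p (gcd r q) = 1 \<and>
     of_int q powr i * \<bar>of_int q * \<theta> - of_int p\<bar> \<le> c powr i"

definition line_through :: "int \<Rightarrow> int \<Rightarrow> int \<Rightarrow> int \<times> int \<times> int" where
  "line_through p r q = (SOME (A, B, C). 1 \<le> B \<and> \<bar>of_int A\<bar> \<le> (of_int q :: real) powr i \<and>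
     of_int B \<le> (of_int q :: real) powr j \<and> A * p + B * r + C * q = 0)"

definition placed :: "nat \<Rightarrow> nat \<Rightarrow> int \<Rightarrow> int \<Rightarrow> int \<Rightarrow> int \<Rightarrow> int \<Rightarrow> int \<Rightarrow> bool" where
  "placed m n p r q A B C \<longleftrightarrow> near_point p r q \<and> line_through p r q = (A, B, C) \<and>
     T m \<le> of_int q \<and> of_int q < T (Suc m) \<and>
     Z m n \<le> T m * of_int B \<and> T m * of_int B < Z m (Suc n)"

lemma T_pos [simp]: "0 < T m" "1 \<le> T m" "T m \<noteq> 0" "\<bar>T m\<bar> = T m"
  using R by (auto simp: T_def intro: one_le_power)

lemma G_pos [simp]: "0 < G m n" "G m n \<noteq> 0" "\<bar>G m n\<bar> = G m n"
  using R \<zeta> T_pos(3)[of m] by (auto simp: G_def)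

lemma Z_pos [simp]: "0 < Z m n" "Z m n \<noteq> 0"
  using R \<zeta> G_pos(2)[of m n] by (auto simp: Z_def)

lemma eps_pos: "0 < \<epsilon>"
  using c by (simp add: \<epsilon>_def add_pos_pos)

lemma line_through_props:
  assumes "near_point p r q" "line_through p r q = (A, B, C)"
  shows "1 \<le> B" "\<bar>of_int A\<bar> \<le> (of_int q :: real) powr i" "of_int B \<le> (of_int q :: real) powr j"
    "A * p + B * r + C * q = 0"
proof -
  have "\<exists>A B C :: int. 1 \<le> B \<and> \<bar>of_int A\<bar> \<le> of_int q powr i \<and> of_int B \<le> of_int q powr j
    \<and> A * p + B * r + C * q = 0"
    using assms c(2) by (intro exists_nonvertical_line[OF weights theta]) (auto simp: near_point_def)
  then have "\<exists>w. case w of (A, B, C) \<Rightarrow> 1 \<le> B \<and> \<bar>of_int A\<bar> \<le> (of_int q :: real) powr i \<and>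
     of_int B \<le> (of_int q :: real) powr j \<and> A * p + B * r + C * q = 0" by auto
  from someI_ex[OF this] assms(2)
  show "1 \<le> B" "\<bar>of_int A\<bar> \<le> (of_int q :: real) powr i" "of_int B \<le> (of_int q :: real) powr j"
    "A * p + B * r + C * q = 0"
    by (auto simp: line_through_def)
qed

lemma placed_props:
  assumes "placed m n p r q A B C"
  shows "1 \<le> B" "\<bar>of_int A\<bar> \<le> (of_int q :: real) powr i" "of_int B \<le> (of_int q :: real) powr j"
    "A * p + B * r + C * q = 0"
    and "1 \<le> q" "of_int q powr i * \<bar>of_int q * \<theta> - of_int p\<bar> \<le> c powr i"
    and "T m \<le> of_int q" "of_int q < R * T m" "Z m n \<le> T m * of_int B"
    and "gcd p (gcd r q) = 1"
  using assms line_through_props[of p r q A B C]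
  by (auto simp: placed_def near_point_def T_def)

lemma R_powr_le: "0 \<le> t \<Longrightarrow> t \<le> 1 \<Longrightarrow> R powr t \<le> R"
  using R powr_mono[of t 1 R] by simp

text \<open>
Both coefficients are expressed through \<open>T\<close> and \<open>G\<close>. The lower bounds for \<open>G\<close> come from \<open>B \<le> q\<^sup>j\<close>; they say
that only classes \<open>m\<close> with \<open>T\<^bsup>1+j\<^esup>\<close> at least of the order of \<open>\<zeta> R\<^sup>n\<close> contribute to level \<open>n\<close>.
\<close>

lemma placed_size:
  assumes P: "placed m n p r q A B C"
  shows "R powr - 2 \<le> G m n" "1 / R \<le> G m n powr \<nu>"
    and "\<bar>of_int A\<bar> \<le> R * T m powr i"
    and "T m * of_int B \<le> R * Z m n"
    and "of_int B \<le> R * T m powr j * G m n powr (\<nu> - 1)"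
proof -
  note pp = placed_props[OF P]
  have q0: "0 < real_of_int q" using pp(5) by simp
  have pow: "of_int q powr t \<le> R * T m powr t" if "0 \<le> t" "t \<le> 1" for t
  proof -
    have "of_int q powr t \<le> (R * T m) powr t"
      using pp q0 that by (intro powr_mono2) auto
    also have "\<dots> = R powr t * T m powr t" by (rule powr_mult)
    also have "\<dots> \<le> R * T m powr t" using R_powr_le that by (intro mult_right_mono) auto
    finally show ?thesis .
  qed
  show "\<bar>of_int A\<bar> \<le> R * T m powr i"
    using pp(2) pow[of i] weights by simp
  have "of_int B \<le> R * T m powr j" using pp(3) pow[of j] weights by simp
  then have "Z m n \<le> T m * (R * T m powr j)"
    using pp(9) by (meson T_pos(1) less_imp_le mult_left_mono order_trans)
  also have "\<dots> = R * (\<zeta> * R ^ n * G m n)"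
    using \<zeta> R by (simp add: G_def powr_add)
  finally have "G m n powr \<nu> \<le> R * G m n"
    using \<zeta> R by (simp add: Z_def mult.left_commute[of R])
  also have "\<dots> = (R * G m n powr (1 - \<nu>)) * G m n powr \<nu>"
    by (simp flip: powr_add)
  finally have one: "1 \<le> R * G m n powr (1 - \<nu>)"
    using G_pos[of m n] by (simp add: mult_le_cancel_right1)
  show G2: "R powr - 2 \<le> G m n"
  proof (rule ccontr)
    assume "\<not> ?thesis"
    then have "G m n powr (1 - \<nu>) < (R powr - 2) powr (1 - \<nu>)"
      using \<nu> by (intro powr_less_mono2) (auto simp: less_imp_le)
    also have "\<dots> \<le> R powr - 1"
      unfolding powr_powr using R \<nu> by (intro powr_mono) auto
    finally have "R * G m n powr (1 - \<nu>) < R * R powr - 1"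
      using R by (intro mult_strict_left_mono) auto
    then show False using one R by (simp add: powr_minus)
  qed
  have "R powr - 1 \<le> (R powr - 2) powr \<nu>"
    unfolding powr_powr using R \<nu> by (intro powr_mono) auto
  also have "\<dots> \<le> G m n powr \<nu>" using G2 \<nu> by (intro powr_mono2) auto
  finally show "1 / R \<le> G m n powr \<nu>" using R by (simp add: powr_minus_divide)
  have "G m (Suc n) \<le> G m n"
    unfolding G_def using R \<zeta> by (intro divide_left_mono) auto
  then have "Z m (Suc n) \<le> R * Z m n"
    unfolding Z_def using R \<zeta> \<nu>
    by (simp add: mult.left_commute[of _ R] powr_mono2 less_imp_le)
  then show TB: "T m * of_int B \<le> R * Z m n" using P by (auto simp: placed_def)
  have "T m * of_int B \<le> R * (\<zeta> * R ^ n * (G m n powr (\<nu> - 1) * G m n powr 1))"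
    using TB unfolding Z_def powr_add[symmetric] by (simp add: mult_ac)
  also have "\<dots> = T m * (R * T m powr j * G m n powr (\<nu> - 1))"
    using \<zeta> R by (simp add: G_def[of m n] powr_add abs_mult)
  finally show "of_int B \<le> R * T m powr j * G m n powr (\<nu> - 1)" by simp
qed

lemma value_near_crossing:
  assumes P: "placed m n p r q A B C"
    and x: "\<bar>- (of_int A * \<theta> + of_int C) / of_int B - x\<bar> \<le> \<epsilon> / Z m n + (1 / R) ^ n"
  shows "\<bar>of_int A * \<theta> + of_int B * x + of_int C\<bar> \<le> 2 * R * \<zeta> * G m n powr \<nu> / T m"
proof -
  have B: "0 < real_of_int B" using placed_props(1)[OF P] by simp
  have eps: "\<epsilon> \<le> \<zeta> * G m n powr \<nu>"
  proof -
    have "\<epsilon> \<le> \<zeta> / R\<^sup>2" using small_radius R by (simp add: \<epsilon>_def field_simps)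
    also have "\<dots> \<le> \<zeta> / R" using R \<zeta> by (intro divide_left_mono) (auto simp: power2_eq_square)
    also have "\<dots> = \<zeta> * (1 / R)" by simp
    also have "\<dots> \<le> \<zeta> * G m n powr \<nu>" using placed_size(2)[OF P] \<zeta> by (intro mult_left_mono) auto
    finally show ?thesis .
  qed
  have "of_int A * \<theta> + of_int B * x + of_int C
      = - of_int B * (- (of_int A * \<theta> + of_int C) / of_int B - x)"
    using B by (simp add: field_simps)
  then have "\<bar>of_int A * \<theta> + of_int B * x + of_int C\<bar>
      = of_int B * \<bar>- (of_int A * \<theta> + of_int C) / of_int B - x\<bar>"
    using B by (simp add: abs_mult)
  also have "\<dots> \<le> of_int B * (\<epsilon> / Z m n + (1 / R) ^ n)"
    using B x by (intro mult_left_mono) auto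
  also have "\<dots> \<le> (R * Z m n / T m) * (\<epsilon> / Z m n + (1 / R) ^ n)"
    using placed_size(4)[OF P] eps_pos R
    by (intro mult_right_mono) (auto simp: field_simps less_imp_le intro!: add_nonneg_nonneg)
  also have "\<dots> = R * (\<epsilon> + Z m n * (1 / R) ^ n) / T m"
    by (simp add: field_simps)
  also have "Z m n * (1 / R) ^ n = \<zeta> * G m n powr \<nu>"
    using R by (simp add: Z_def power_divide)
  also have "R * (\<epsilon> + \<zeta> * G m n powr \<nu>) / T m \<le> R * (2 * (\<zeta> * G m n powr \<nu>)) / T m"
    using eps R T_pos(1)[of m] by (intro divide_right_mono mult_left_mono) (auto intro: less_imp_le)
  finally show ?thesis by (simp add: mult_ac)
qed

text \<open>
The left-hand side is an integer. It is small because the rational point is close to the fibre (by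
\<open>near_point\<close>) and both crossing points are close to \<open>x\<close>.
\<close>

lemma incident_in_near_regime:
  assumes P1: "placed m n p1 r1 q1 A1 B1 C1" and P2: "placed m n p2 r2 q2 A2 B2 C2"
    and x1: "\<bar>- (of_int A1 * \<theta> + of_int C1) / of_int B1 - x\<bar> \<le> \<epsilon> / Z m n + (1 / R) ^ n"
    and x2: "\<bar>- (of_int A2 * \<theta> + of_int C2) / of_int B2 - x\<bar> \<le> \<epsilon> / Z m n + (1 / R) ^ n"
    and G: "G m n \<le> G0"
  shows "A1 * p2 + B1 * r2 + C1 * q2 = 0"
proof -
  note pp1 = placed_props[OF P1] and pp2 = placed_props[OF P2]
  define W1 where "W1 = of_int A1 * \<theta> + of_int B1 * x + of_int C1"
  define W2 where "W2 = of_int A2 * \<theta> + of_int B2 * x + of_int C2"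
  define \<delta> where "\<delta> = of_int q2 * \<theta> - of_int p2"
  define \<gamma> where "\<gamma> = of_int q2 * x - of_int r2"
  define w where "w = 2 * R\<^sup>2 * \<zeta> * G m n powr \<nu>"
  have q2: "0 < real_of_int q2" using pp2(5) by simp
  have W: "of_int q2 * \<bar>W\<bar> \<le> w" if "\<bar>W\<bar> \<le> 2 * R * \<zeta> * G m n powr \<nu> / T m" for W
  proof -
    have "of_int q2 * \<bar>W\<bar> \<le> (R * T m) * (2 * R * \<zeta> * G m n powr \<nu> / T m)"
      using that pp2(8) q2 by (intro mult_mono) auto
    then show ?thesis by (simp add: w_def power2_eq_square mult_ac)
  qed
  have W1: "of_int q2 * \<bar>W1\<bar> \<le> w" and W2: "of_int q2 * \<bar>W2\<bar> \<le> w"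
    unfolding W1_def W2_def
    using value_near_crossing[OF P1 x1] value_near_crossing[OF P2 x2] by (intro W; simp)+
  have \<delta>2: "\<bar>of_int A2\<bar> * \<bar>\<delta>\<bar> \<le> c powr i"
    using mult_right_mono[OF pp2(2), of "\<bar>\<delta>\<bar>"] pp2(6) by (simp add: \<delta>_def)
  have \<delta>1: "\<bar>of_int A1\<bar> * \<bar>\<delta>\<bar> \<le> R * c powr i"
  proof -
    have "of_int q1 powr i \<le> (R * of_int q2) powr i"
      using pp1(5,8) pp2(7) R weights
      by (intro powr_mono2) (auto intro: order_trans[OF less_imp_le] mult_left_mono)
    also have "\<dots> = R powr i * of_int q2 powr i" by (rule powr_mult)
    also have "\<dots> \<le> R * of_int q2 powr i"
      using R_powr_le[of i] weights by (intro mult_right_mono) auto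
    finally have "\<bar>of_int A1\<bar> \<le> R * of_int q2 powr i" using pp1(2) by simp
    then have "\<bar>of_int A1\<bar> * \<bar>\<delta>\<bar> \<le> R * of_int q2 powr i * \<bar>\<delta>\<bar>" by (intro mult_right_mono) auto
    also have "\<dots> = R * (of_int q2 powr i * \<bar>\<delta>\<bar>)" by simp
    also have "\<dots> \<le> R * c powr i" using pp2(6) R by (intro mult_left_mono) (auto simp: \<delta>_def)
    finally show ?thesis .
  qed
  \<comment> \<open>The point lies on its own line, which bounds its vertical distance \<open>\<gamma>\<close> from the height \<open>x\<close>.\<close>
  have "real_of_int (A2 * p2 + B2 * r2 + C2 * q2) = - of_int A2 * \<delta> - of_int B2 * \<gamma> + of_int q2 * W2"
    by (simp add: \<delta>_def \<gamma>_def W2_def algebra_simps)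
  then have "of_int B2 * \<gamma> = - of_int A2 * \<delta> + of_int q2 * W2" using pp2(4) by simp
  then have "of_int B2 * \<bar>\<gamma>\<bar> = \<bar>- of_int A2 * \<delta> + of_int q2 * W2\<bar>"
    using pp2(1) by (metis abs_mult abs_of_nonneg of_int_0_le_iff order_trans zero_le_one)
  also have "\<dots> \<le> \<bar>of_int A2\<bar> * \<bar>\<delta>\<bar> + of_int q2 * \<bar>W2\<bar>"
    using q2 by (intro order_trans[OF abs_triangle_ineq]) (simp add: abs_mult)
  finally have \<gamma>: "of_int B2 * \<bar>\<gamma>\<bar> \<le> c powr i + w" using \<delta>2 W2 by linarith
  have "T m * of_int B1 \<le> T m * (R * of_int B2)"
    using placed_size(4)[OF P1] pp2(9) R
    by (smt (verit) mult.left_commute mult_left_mono)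
  then have "of_int B1 \<le> R * of_int B2" by simp
  then have "of_int B1 * \<bar>\<gamma>\<bar> \<le> R * (of_int B2 * \<bar>\<gamma>\<bar>)"
    using mult_right_mono[of "of_int B1" "R * of_int B2" "\<bar>\<gamma>\<bar>"] by (simp add: mult_ac)
  also have "\<dots> \<le> R * (c powr i + w)" using \<gamma> R by (intro mult_left_mono) auto
  finally have B1: "of_int B1 * \<bar>\<gamma>\<bar> \<le> R * (c powr i + w)" .
  have "real_of_int (A1 * p2 + B1 * r2 + C1 * q2) = - of_int A1 * \<delta> - of_int B1 * \<gamma> + of_int q2 * W1"
    by (simp add: \<delta>_def \<gamma>_def W1_def algebra_simps)
  also have "\<bar>\<dots>\<bar> \<le> \<bar>of_int A1\<bar> * \<bar>\<delta>\<bar> + of_int B1 * \<bar>\<gamma>\<bar> + of_int q2 * \<bar>W1\<bar>"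
    using q2 pp1(1) by (intro order_trans[OF abs_triangle_ineq] order_trans[OF abs_triangle_ineq4] add_mono)
      (simp_all add: abs_mult)
  also have "\<dots> \<le> R * c powr i + R * (c powr i + w) + w" using \<delta>1 B1 W1 by linarith
  also have "\<dots> \<le> 2 * R * c powr i + 2 * R * w"
  proof -
    have "0 \<le> w" using R \<zeta> by (simp add: w_def)
    then have "w \<le> R * w" using R mult_right_mono[of 1 R w] by simp
    then show ?thesis by (simp add: algebra_simps)
  qed
  also have "2 * R * w = 4 * R ^ 3 * \<zeta> * G m n powr \<nu>"
    by (simp add: w_def power2_eq_square power3_eq_cube)
  also have "2 * R * c powr i + 4 * R ^ 3 * \<zeta> * G m n powr \<nu> \<le> 2 * R * c powr i + 4 * R ^ 3 * \<zeta> * G0 powr \<nu>"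
    using G \<nu> \<zeta> R by (intro add_left_mono mult_left_mono powr_mono2) (auto simp: less_imp_le)
  also have "\<dots> < 1" by (rule near_regime)
  finally show ?thesis by linarith
qed

abbreviation crossing :: "int \<Rightarrow> int \<Rightarrow> int \<Rightarrow> real" where
  "crossing A B C \<equiv> - (of_int A * \<theta> + of_int C) / of_int B"

lemma Z_geometric: "Z m n = (\<zeta> * G m 0 powr \<nu>) * (R powr (1 - \<nu>)) ^ n"
proof -
  have Rn: "(R powr t) ^ n = (R ^ n) powr t" for t
    using R by (simp add: powr_powr mult.commute flip: powr_realpow)
  have "G m n = G m 0 / R ^ n" by (simp add: G_def)
  then have "Z m n = \<zeta> * G m 0 powr \<nu> * (R ^ n / (R ^ n) powr \<nu>)"
    by (simp add: Z_def powr_divide)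
  also have "R ^ n / (R ^ n) powr \<nu> = (R ^ n) powr (1 - \<nu>)"
    using R by (simp add: powr_diff)
  finally show ?thesis by (simp add: Rn)
qed

lemma exists_placed:
  assumes P: "near_point p r q"
  shows "\<exists>m n A B C. placed m n p r q A B C"
proof -
  obtain A B C where L: "line_through p r q = (A, B, C)" by (metis prod_cases3)
  have B: "1 \<le> B" using line_through_props(1)[OF P L] .
  obtain m where m: "T m \<le> of_int q" "of_int q < T (Suc m)"
    using exists_power_bracket[of R "of_int q"] R P by (auto simp: T_def near_point_def)
  define u where "u = \<zeta> * G m 0 powr \<nu>"
  have u0: "0 < u" using \<zeta> by (simp add: u_def)
  have "u = \<zeta> powr 1 * \<zeta> powr (- \<nu>) * T m powr ((1 + j) * \<nu>)"
    using \<zeta> by (simp add: u_def G_def powr_divide powr_powr powr_minus_divide)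
  also have "\<dots> = \<zeta> powr (1 - \<nu>) * T m powr ((1 + j) * \<nu>)"
    using \<zeta> powr_add[of \<zeta> 1 "- \<nu>"] by simp
  also have "\<dots> \<le> 1 * T m powr 1"
  proof (intro mult_mono powr_mono)
    show "\<zeta> powr (1 - \<nu>) \<le> 1" using \<zeta> \<nu> by (intro powr_le1) auto
    have "(1 + j) * \<nu> \<le> 2 * (1 / 2)" using weights \<nu> by (intro mult_mono) auto
    then show "(1 + j) * \<nu> \<le> 1" by simp
  qed auto
  finally have "u \<le> T m" by simp
  moreover have "T m * 1 \<le> T m * of_int B" using B by (intro mult_left_mono) (auto intro: less_imp_le)
  ultimately have "u \<le> T m * of_int B" by linarith
  then have x: "1 \<le> T m * of_int B / u" using u0 by simp
  have "1 < R powr (1 - \<nu>)" using R \<nu> by simp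
  from exists_power_bracket[OF this x] obtain n where
    n: "(R powr (1 - \<nu>)) ^ n \<le> T m * of_int B / u" "T m * of_int B / u < (R powr (1 - \<nu>)) ^ Suc n" by blast
  have "Z m n \<le> T m * of_int B" "T m * of_int B < Z m (Suc n)"
    using n u0 unfolding Z_geometric u_def[symmetric] by (simp_all only: le_divide_eq divide_less_eq if_True mult.commute)
  then show ?thesis using P L m unfolding placed_def by blast
qed

text \<open>
A rational point close to the fibre forbids the heights \<open>y\<close> that it approximates too well. They all lie in
the neighbourhood of a single crossing point, namely that of the line chosen for the reduced point.
\<close>

lemma bad_interval_covered:
  fixes p r q :: int
  assumes "1 \<le> q" and near: "of_int q powr i * \<bar>of_int q * \<theta> - of_int p\<bar> \<le> c powr i"
  obtains m n p' r' q' A B C where "placed m n p' r' q' A B C"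
    "\<And>y. of_int q powr j * \<bar>of_int q * y - of_int r\<bar> \<le> c powr j \<Longrightarrow> \<bar>crossing A B C - y\<bar> \<le> \<epsilon> / Z m n"
proof -
  obtain g p' r' q' where g: "1 \<le> g" "p = g * p'" "r = g * r'" "q = g * q'" "1 \<le> q'" "gcd p' (gcd r' q') = 1"
    using primitive_reduction[OF \<open>1 \<le> q\<close>] .
  have reduce: "of_int q' powr t * \<bar>of_int q' * y - of_int a\<bar> \<le> of_int q powr t * \<bar>of_int q * y - of_int (g * a)\<bar>"
    if "0 \<le> t" for t y :: real and a
  proof (intro mult_mono powr_mono2)
    show "real_of_int q' \<le> of_int q" using g by simp
    have "\<bar>of_int q * y - of_int (g * a)\<bar> = of_int g * \<bar>of_int q' * y - of_int a\<bar>"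
      using g by (simp add: abs_mult right_diff_distrib[symmetric] mult.assoc)
    moreover have "1 * \<bar>of_int q' * y - of_int a\<bar> \<le> of_int g * \<bar>of_int q' * y - of_int a\<bar>"
      using g by (intro mult_right_mono) auto
    ultimately show "\<bar>of_int q' * y - of_int a\<bar> \<le> \<bar>of_int q * y - of_int (g * a)\<bar>" by simp
  qed (use that g in auto)
  have near': "of_int q' powr i * \<bar>of_int q' * \<theta> - of_int p'\<bar> \<le> c powr i"
    using order_trans[OF reduce near[unfolded g(2)]] weights by simp
  then have P: "near_point p' r' q'" using g by (simp add: near_point_def)
  from exists_placed[OF this] obtain m n A B C where pl: "placed m n p' r' q' A B C" by blast
  note pp = placed_props[OF pl]
  show ?thesis
  proof (rule that[OF pl])
    fix y assume "of_int q powr j * \<bar>of_int q * y - of_int r\<bar> \<le> c powr j"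
    then have y: "of_int q' powr j * \<bar>of_int q' * y - of_int r'\<bar> \<le> c powr j"
      using order_trans[OF reduce[of j y r']] weights g(3) by simp
    have B: "0 < real_of_int B" and q': "0 < real_of_int q'" using pp by auto
    have "real_of_int (A * p' + B * r' + C * q') = 0" using pp(4) by simp
    then have "of_int q' * of_int B * (crossing A B C - y)
        = - (of_int A * (of_int q' * \<theta> - of_int p')) - of_int B * (of_int q' * y - of_int r')"
      using B by (simp add: field_simps)
    then have "of_int q' * of_int B * \<bar>crossing A B C - y\<bar>
        = \<bar>- (of_int A * (of_int q' * \<theta> - of_int p')) - of_int B * (of_int q' * y - of_int r')\<bar>"
      using B q' by (metis abs_mult abs_of_pos mult_pos_pos)
    also have "\<dots> \<le> \<bar>of_int A\<bar> * \<bar>of_int q' * \<theta> - of_int p'\<bar> + of_int B * \<bar>of_int q' * y - of_int r'\<bar>"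
      using B by (intro order_trans[OF abs_triangle_ineq4]) (simp add: abs_mult)
    also have "\<dots> \<le> of_int q' powr i * \<bar>of_int q' * \<theta> - of_int p'\<bar> + of_int q' powr j * \<bar>of_int q' * y - of_int r'\<bar>"
      using pp(2,3) by (intro add_mono mult_right_mono) auto
    also have "\<dots> \<le> \<epsilon>" using near' y by (simp add: \<epsilon>_def)
    finally have le: "of_int q' * of_int B * \<bar>crossing A B C - y\<bar> \<le> \<epsilon>" .
    have "Z m n \<le> T m * of_int B" by (rule pp(9))
    also have "\<dots> \<le> of_int q' * of_int B" using pp(7) B by (intro mult_right_mono) auto
    finally have "Z m n * \<bar>crossing A B C - y\<bar> \<le> \<epsilon>"
      using le by (meson abs_ge_zero mult_right_mono order_trans)
    then show "\<bar>crossing A B C - y\<bar> \<le> \<epsilon> / Z m n"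
      by (simp add: pos_le_divide_eq mult.commute)
  qed
qed

lemma radius_less_scale:
  assumes "placed m n p r q A B C"
  shows "\<epsilon> / Z m n < (1 / R) ^ n"
proof -
  have "\<epsilon> * R\<^sup>2 \<le> \<zeta>" using small_radius by (simp add: \<epsilon>_def)
  moreover have "\<epsilon> * R < \<epsilon> * R\<^sup>2"
    using R eps_pos by (intro mult_strict_left_mono) (auto simp: power2_eq_square)
  ultimately have "\<epsilon> < \<zeta> * (1 / R)" using R by (simp add: field_simps)
  also have "\<dots> \<le> \<zeta> * G m n powr \<nu>" using placed_size(2)[OF assms] \<zeta> by (intro mult_left_mono) auto
  also have "\<dots> = Z m n * (1 / R) ^ n" using R by (simp add: Z_def power_divide)
  finally show ?thesis by (simp add: pos_divide_less_eq mult.commute)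
qed

text \<open>
The conclusion says that the two lines coincide. The cross product
\<open>(p, r, q)\<close> of the two lines is their common rational point. In coordinates adapted to
\<open>(\<theta>, x)\<close> the vectors are \<open>(A, B, W)\<close> with \<open>W\<close> the value at \<open>(\<theta>, x)\<close>, so the components \<open>q \<theta> - p\<close>,
\<open>q x - r\<close> and \<open>q\<close> are bounded by \<open>2 b w\<close>, \<open>2 a w\<close> and \<open>2 a b\<close>. For large \<open>G\<close> this makes the point, when \<open>q \<noteq> 0\<close>,
close to the fibre and an approximation of every height within \<open>R\<^sup>-\<^sup>n\<close> of \<open>x\<close>. The corresponding
neighbourhood contains the ball and hence, by \<open>radius_less_scale\<close>, has level below \<open>n\<close>, against the
assumption \<open>free\<close>. If \<open>q = 0\<close>, the bound for \<open>q \<theta> - p\<close> leaves only \<open>p = 0\<close>.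
\<close>

lemma far_regime_dependent:
  assumes P1: "placed m n p1 r1 q1 A1 B1 C1" and P2: "placed m n p2 r2 q2 A2 B2 C2"
    and x1: "\<bar>crossing A1 B1 C1 - x\<bar> \<le> \<epsilon> / Z m n + (1 / R) ^ n"
    and x2: "\<bar>crossing A2 B2 C2 - x\<bar> \<le> \<epsilon> / Z m n + (1 / R) ^ n"
    and G: "G0 \<le> G m n"
    and free: "\<And>m' n' p r q A B C. placed m' n' p r q A B C \<Longrightarrow> n' < n \<Longrightarrow>
       \<epsilon> / Z m' n' < \<bar>crossing A B C - x\<bar> + (1 / R) ^ n"
  shows "A1 * B2 = A2 * B1 \<and> B1 * C2 = B2 * C1"
proof -
  note pp1 = placed_props[OF P1] and pp2 = placed_props[OF P2]
  note ps1 = placed_size[OF P1] and ps2 = placed_size[OF P2]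
  define g where "g = G m n"
  define t where "t = T m"
  define W1 where "W1 = of_int A1 * \<theta> + of_int B1 * x + of_int C1"
  define W2 where "W2 = of_int A2 * \<theta> + of_int B2 * x + of_int C2"
  define p where "p = B1 * C2 - B2 * C1"
  define r where "r = C1 * A2 - C2 * A1"
  define q where "q = A1 * B2 - A2 * B1"
  define a where "a = R * t powr i"
  define b where "b = R * t powr j * g powr (\<nu> - 1)"
  define w where "w = 2 * R * \<zeta> * g powr \<nu> / t"
  have t: "0 < t" "1 \<le> t" and g: "0 < g" "1 \<le> g" using G G0 by (auto simp: t_def g_def)
  have nonneg: "0 \<le> a" "0 \<le> b" "0 \<le> w" using R \<zeta> t g by (auto simp: a_def b_def w_def)
  have A: "\<bar>of_int A1\<bar> \<le> a" "\<bar>of_int A2\<bar> \<le> a"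
    using ps1(3) ps2(3) by (simp_all add: a_def t_def)
  have B: "\<bar>of_int B1\<bar> \<le> b" "\<bar>of_int B2\<bar> \<le> b"
    using ps1(5) ps2(5) pp1(1) pp2(1) by (simp_all add: b_def t_def g_def)
  have W: "\<bar>W1\<bar> \<le> w" "\<bar>W2\<bar> \<le> w"
    using value_near_crossing[OF P1 x1] value_near_crossing[OF P2 x2]
    by (simp_all add: W1_def W2_def w_def t_def g_def)
  have two: "\<bar>u1 * v2 - u2 * v1\<bar> \<le> 2 * (u * v)"
    if "\<bar>u1\<bar> \<le> u" "\<bar>u2\<bar> \<le> u" "\<bar>v1\<bar> \<le> v" "\<bar>v2\<bar> \<le> v" for u1 u2 v1 v2 u v :: real
  proof -
    have "\<bar>u1 * v2 - u2 * v1\<bar> \<le> \<bar>u1\<bar> * \<bar>v2\<bar> + \<bar>u2\<bar> * \<bar>v1\<bar>"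
      by (metis abs_mult abs_triangle_ineq4)
    also have "\<dots> \<le> u * v + u * v"
      using that by (intro add_mono mult_mono) auto
    finally show ?thesis by simp
  qed
  have "of_int p - of_int q * \<theta> = of_int B1 * W2 - of_int B2 * W1"
    by (simp add: p_def q_def W1_def W2_def algebra_simps)
  then have p_le: "\<bar>of_int q * \<theta> - of_int p\<bar> \<le> 2 * (b * w)"
    using two[OF B W] by (simp add: abs_minus_commute)
  have "of_int r - of_int q * x = of_int A2 * W1 - of_int A1 * W2"
    by (simp add: r_def q_def W1_def W2_def algebra_simps)
  then have r_le: "\<bar>of_int q * x - of_int r\<bar> \<le> 2 * (a * w)"
    using two[OF A(2,1) W(2,1)] by (simp add: abs_minus_commute)
  have q_le: "\<bar>of_int q\<bar> \<le> 2 * (a * b)"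
    using two[OF A B] by (simp add: q_def)
  have tij: "t powr i * t powr j = t" using weights t by (simp flip: powr_add)
  have bw: "2 * (b * w) = 4 * R\<^sup>2 * \<zeta> * g powr (2 * \<nu> - 1) / t powr i"
  proof -
    have "g powr (2 * \<nu> - 1) = g powr (\<nu> - 1) * g powr \<nu>" by (simp flip: powr_add)
    moreover have "t powr j / t = 1 / t powr i" using tij t by (simp add: field_simps)
    moreover have "2 * (b * w) = 4 * R\<^sup>2 * \<zeta> * (g powr (\<nu> - 1) * g powr \<nu>) * (t powr j / t)"
      by (simp add: b_def w_def power2_eq_square)
    ultimately show ?thesis by simp
  qed
  have aw: "2 * (a * w) = 4 * R\<^sup>2 * \<zeta> * g powr \<nu> / t powr j"
  proof -
    have "t powr i / t = 1 / t powr j" using tij t by (simp add: field_simps)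
    moreover have "2 * (a * w) = 4 * R\<^sup>2 * \<zeta> * g powr \<nu> * (t powr i / t)"
      by (simp add: a_def w_def power2_eq_square)
    ultimately show ?thesis by simp
  qed
  have ab: "2 * (a * b) = 2 * R\<^sup>2 * t * g powr (\<nu> - 1)"
    using tij by (simp add: a_def b_def power2_eq_square mult_ac)
  have R4: "2 * R\<^sup>2 * (4 * R\<^sup>2 * u) = 8 * R ^ 4 * u" "2 * R\<^sup>2 * (6 * R\<^sup>2 * u) = 12 * R ^ 4 * u" for u
    by (simp_all add: power2_eq_square power4_eq_xxxx)
  have "1 \<le> R\<^sup>2" using R by (intro one_le_power) auto
  then have R2: "1 \<le> 2 * R\<^sup>2" by linarith
  have height: "\<bar>of_int q\<bar> powr e \<le> 2 * R\<^sup>2 * t powr e * g powr ((\<nu> - 1) * e)" if e: "0 \<le> e" "e \<le> 1" for e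
  proof -
    have "\<bar>real_of_int q\<bar> powr e \<le> (2 * R\<^sup>2 * t * g powr (\<nu> - 1)) powr e"
      using q_le e unfolding ab by (intro powr_mono2) auto
    also have "\<dots> = (2 * R\<^sup>2) powr e * t powr e * g powr ((\<nu> - 1) * e)"
      by (simp only: powr_mult powr_powr)
    also have "\<dots> \<le> (2 * R\<^sup>2) * t powr e * g powr ((\<nu> - 1) * e)"
      using powr_mono[OF e(2) R2] R2 by (intro mult_right_mono) auto
    finally show ?thesis .
  qed
  show ?thesis
  proof (cases "q = 0")
    case True
    have "\<bar>real_of_int p\<bar> \<le> 4 * R\<^sup>2 * \<zeta> * g powr (2 * \<nu> - 1) / t powr i"
      using p_le True bw by simp
    also have "\<dots> \<le> 4 * R\<^sup>2 * 1 * g powr (2 * \<nu> - 1) / 1"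
      using \<zeta> t weights by (intro divide_mono mult_mono) (auto intro!: ge_one_powr_ge_zero mult_nonneg_nonneg)
    also have "\<dots> \<le> (2 * R\<^sup>2 * (4 * R\<^sup>2 * g powr (2 * \<nu> - 1))) / 2"
    proof -
      have "4 * R\<^sup>2 * g powr (2 * \<nu> - 1) * 1 \<le> 4 * R\<^sup>2 * g powr (2 * \<nu> - 1) * R\<^sup>2"
        using R by (intro mult_left_mono) (auto simp: one_le_power)
      then show ?thesis by (simp add: mult_ac)
    qed
    also have "\<dots> \<le> c powr i / 2"
      unfolding R4 using far_regime(1)[OF G] by (simp add: g_def)
    also have "c powr i < 1"
    proof -
      have "0 \<le> 4 * R ^ 3 * \<zeta> * G0 powr \<nu>" using R \<zeta> by simp
      then have "2 * R * c powr i < 1" using near_regime by linarith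
      moreover have "1 * c powr i \<le> 2 * R * c powr i" using R by (intro mult_right_mono) auto
      ultimately show ?thesis by simp
    qed
    finally have "p = 0" by linarith
    then show ?thesis using True by (simp add: p_def q_def)
  next
    case False
    \<comment> \<open>The rational point where the two lines meet is \<open>(p/q, r/q)\<close>, up to a common sign.\<close>
    define \<sigma> where "\<sigma> = sgn q"
    have \<sigma>: "\<bar>\<sigma>\<bar> = 1" "\<sigma> * q = \<bar>q\<bar>" using False by (auto simp: \<sigma>_def abs_sgn sgn_if)
    have sign: "\<bar>of_int (\<sigma> * q) * y - of_int (\<sigma> * k)\<bar> = \<bar>of_int q * y - of_int k\<bar>" for y :: real and k
    proof -
      have "of_int (\<sigma> * q) * y - of_int (\<sigma> * k) = of_int \<sigma> * (of_int q * y - of_int k)"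
        by (simp add: algebra_simps)
      moreover have "\<bar>real_of_int \<sigma>\<bar> = 1" using \<sigma>(1) by linarith
      ultimately show ?thesis by (simp only: abs_mult mult_1)
    qed
    have "of_int \<bar>q\<bar> powr i * \<bar>of_int q * \<theta> - of_int p\<bar>
        \<le> (2 * R\<^sup>2 * t powr i * g powr ((\<nu> - 1) * i)) * (2 * (b * w))"
      using height[of i] weights p_le R by (intro mult_mono) auto
    also have "\<dots> \<le> (2 * R\<^sup>2 * t powr i * 1) * (4 * R\<^sup>2 * 1 * g powr (2 * \<nu> - 1) / t powr i)"
      unfolding bw
    proof (intro mult_mono divide_right_mono)
      have "g powr ((\<nu> - 1) * i) \<le> g powr 0"
        using g \<nu> weights by (intro powr_mono) (auto simp: mult_nonpos_nonneg)
      then show "g powr ((\<nu> - 1) * i) \<le> 1" using g by simp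
    qed (use \<zeta> in auto)
    also have "\<dots> = 2 * R\<^sup>2 * (4 * R\<^sup>2 * g powr (2 * \<nu> - 1))" using t by simp
    also have "\<dots> \<le> c powr i" unfolding R4 using far_regime(1)[OF G] by (simp add: g_def)
    finally have near: "of_int (\<sigma> * q) powr i * \<bar>of_int (\<sigma> * q) * \<theta> - of_int (\<sigma> * p)\<bar> \<le> c powr i"
      by (simp only: sign, simp only: \<sigma>(2))
    have "1 \<le> \<sigma> * q" using False by (simp add: \<sigma>(2))
    then obtain m' n' p' r' q' A B C where pl: "placed m' n' p' r' q' A B C"
      and cov: "\<And>y. of_int (\<sigma> * q) powr j * \<bar>of_int (\<sigma> * q) * y - of_int (\<sigma> * r)\<bar> \<le> c powr j
          \<Longrightarrow> \<bar>crossing A B C - y\<bar> \<le> \<epsilon> / Z m' n'"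
      using bad_interval_covered[OF _ near, of "\<sigma> * r"] by blast
    have scale: "2 * (a * b) * (1 / R) ^ n = 2 * R\<^sup>2 * \<zeta> * g powr \<nu> / t powr j"
    proof -
      have eq: "(1 / R) ^ n = \<zeta> * g / (t * t powr j)"
        using \<zeta> R by (simp add: g_def G_def t_def powr_add power_divide)
      have "2 * (a * b) * (1 / R) ^ n = 2 * R\<^sup>2 * \<zeta> * (g powr (\<nu> - 1) * g) / t powr j"
        unfolding ab eq using t by simp
      moreover have "g powr (\<nu> - 1) * g = g powr \<nu>" using g by (simp add: powr_diff)
      ultimately show ?thesis by simp
    qed
    have bad: "\<bar>crossing A B C - y\<bar> \<le> \<epsilon> / Z m' n'" if y: "\<bar>y - x\<bar> \<le> (1 / R) ^ n" for y
    proof (rule cov)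
      have "of_int q * y - of_int r = (of_int q * x - of_int r) + of_int q * (y - x)"
        by (simp add: algebra_simps)
      then have "\<bar>of_int q * y - of_int r\<bar> \<le> \<bar>of_int q * x - of_int r\<bar> + \<bar>of_int q\<bar> * \<bar>y - x\<bar>"
        by (metis abs_mult abs_triangle_ineq)
      also have "\<dots> \<le> 2 * (a * w) + 2 * (a * b) * (1 / R) ^ n"
        using r_le q_le y nonneg by (intro add_mono mult_mono) auto
      also have "\<dots> = 6 * R\<^sup>2 * \<zeta> * g powr \<nu> / t powr j" by (simp add: aw scale)
      finally have y_le: "\<bar>of_int q * y - of_int r\<bar> \<le> 6 * R\<^sup>2 * \<zeta> * g powr \<nu> / t powr j" .
      have "of_int \<bar>q\<bar> powr j * \<bar>of_int q * y - of_int r\<bar>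
          \<le> (2 * R\<^sup>2 * t powr j * g powr ((\<nu> - 1) * j)) * (6 * R\<^sup>2 * \<zeta> * g powr \<nu> / t powr j)"
        using height[of j] weights y_le R by (intro mult_mono) auto
      also have "\<dots> = 2 * R\<^sup>2 * (6 * R\<^sup>2 * (\<zeta> * (g powr \<nu> * g powr ((\<nu> - 1) * j))))"
        using t by simp
      also have "g powr \<nu> * g powr ((\<nu> - 1) * j) = g powr (\<nu> + (\<nu> - 1) * j)" by (rule powr_add[symmetric])
      also have "2 * R\<^sup>2 * (6 * R\<^sup>2 * (\<zeta> * g powr (\<nu> + (\<nu> - 1) * j)))
          \<le> 2 * R\<^sup>2 * (6 * R\<^sup>2 * (1 * g powr (\<nu> + (\<nu> - 1) * j)))"
        using \<zeta> by (intro mult_left_mono mult_right_mono) auto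
      also have "\<dots> \<le> c powr j"
        unfolding R4 using far_regime(2)[OF G] by (simp add: g_def)
      finally show "of_int (\<sigma> * q) powr j * \<bar>of_int (\<sigma> * q) * y - of_int (\<sigma> * r)\<bar> \<le> c powr j"
        by (simp only: sign, simp only: \<sigma>(2))
    qed
    have R0: "0 \<le> (1 / R) ^ n" using R by simp
    have contains: "\<bar>crossing A B C - x\<bar> + (1 / R) ^ n \<le> \<epsilon> / Z m' n'"
    proof -
      have "\<bar>x - (1 / R) ^ n - x\<bar> \<le> (1 / R) ^ n" "\<bar>x + (1 / R) ^ n - x\<bar> \<le> (1 / R) ^ n"
        using R0 by linarith+
      from this[THEN bad] show ?thesis by linarith
    qed
    then have "n \<le> n'" using free[OF pl] by force
    moreover have "(1 / R) ^ n < (1 / R) ^ n'"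
      using contains radius_less_scale[OF pl] by linarith
    ultimately show ?thesis
      using R power_decreasing[of n n' "1 / R"] by simp
  qed
qed

text \<open>
In the near regime each of the two lines contains both rational points. Two lines that are not parallel meet
in only one point, so the points agree and the lines, being chosen by the point, agree as well.
\<close>

lemma crossing_unique:
  assumes P1: "placed m n p1 r1 q1 A1 B1 C1" and P2: "placed m n p2 r2 q2 A2 B2 C2"
    and x1: "\<bar>crossing A1 B1 C1 - x\<bar> \<le> \<epsilon> / Z m n + (1 / R) ^ n"
    and x2: "\<bar>crossing A2 B2 C2 - x\<bar> \<le> \<epsilon> / Z m n + (1 / R) ^ n"
    and free: "\<And>m' n' p r q A B C. placed m' n' p r q A B C \<Longrightarrow> n' < n \<Longrightarrow>
       \<epsilon> / Z m' n' < \<bar>crossing A B C - x\<bar> + (1 / R) ^ n"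
  shows "crossing A1 B1 C1 = crossing A2 B2 C2"
proof -
  note pp1 = placed_props[OF P1] and pp2 = placed_props[OF P2]
  have dep: "crossing A1 B1 C1 = crossing A2 B2 C2" if d: "A1 * B2 = A2 * B1" "B1 * C2 = B2 * C1"
  proof -
    have "real_of_int (A1 * B2) = of_int (A2 * B1)" "real_of_int (B1 * C2) = of_int (B2 * C1)"
      by (simp_all only: d)
    then show ?thesis using pp1(1) pp2(1) by (simp add: field_simps)
  qed
  show ?thesis
  proof (cases "G0 \<le> G m n")
    case True
    have "A1 * B2 = A2 * B1 \<and> B1 * C2 = B2 * C1"
      by (rule far_regime_dependent[OF P1 P2 x1 x2 True]) (rule free)
    then show ?thesis using dep by blast
  next
    case False
    define p where "p = B1 * C2 - B2 * C1"
    define r where "r = C1 * A2 - C2 * A1"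
    define q where "q = A1 * B2 - A2 * B1"
    have on: "q * p' = p * q'" "q * r' = r * q'"
      if "A1 * p' + B1 * r' + C1 * q' = 0" "A2 * p' + B2 * r' + C2 * q' = 0" for p' r' q'
    proof -
      have "q * p' - p * q' = B2 * (A1 * p' + B1 * r' + C1 * q') - B1 * (A2 * p' + B2 * r' + C2 * q')"
        "q * r' - r * q' = A1 * (A2 * p' + B2 * r' + C2 * q') - A2 * (A1 * p' + B1 * r' + C1 * q')"
        by (simp_all add: p_def q_def r_def algebra_simps)
      then show "q * p' = p * q'" "q * r' = r * q'" using that by simp_all
    qed
    have G: "G m n \<le> G0" using False by simp
    note on1 = on[OF pp1(4) incident_in_near_regime[OF P2 P1 x2 x1 G]]
      and on2 = on[OF incident_in_near_regime[OF P1 P2 x1 x2 G] pp2(4)]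
    show ?thesis
    proof (cases "q = 0")
      case True
      then have "p = 0" using on1(1) pp1(5) by simp
      then show ?thesis using True by (intro dep) (simp_all add: p_def q_def)
    next
      case False
      have "q * (p1 * q2) = q * (p2 * q1)"
        using on1(1) on2(1) by (metis mult.assoc mult.commute)
      moreover have "q * (r1 * q2) = q * (r2 * q1)"
        using on1(2) on2(2) by (metis mult.assoc mult.commute)
      ultimately have "p1 * q2 = p2 * q1" "r1 * q2 = r2 * q1"
        using False by simp_all
      then have "p1 = p2 \<and> r1 = r2 \<and> q1 = q2"
        using primitive_proportional_eq[OF pp1(10) pp2(10) pp1(5) pp2(5)] by simp
      then have "(A1, B1, C1) = (A2, B2, C2)" using P1 P2 by (metis placed_def)
      then show ?thesis by simp
    qed
  qed
qed

definition line_family :: "nat \<Rightarrow> ((real \<times> real) \<times> real \<times> nat) set" where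
  "line_family m = {((\<theta>, crossing A B C), \<epsilon> / Z m n, n) | n p r q A B C. placed m n p r q A B C}"

lemma line_familyI:
  "placed m n p r q A B C \<Longrightarrow> ((\<theta>, crossing A B C), \<epsilon> / Z m n, n) \<in> line_family m"
  unfolding line_family_def by blast

text \<open>
Each class \<open>m\<close> contributes at most one ball, of radius \<open>\<epsilon> / Z m n\<close>, which is \<open>\<epsilon> / \<zeta>\<close> times \<open>R\<^sup>-\<^sup>n\<close> times
\<open>G m n powr - \<nu>\<close>. The last factor decays geometrically in \<open>m\<close>, and this is the purpose of the exponent \<open>\<nu>\<close>.
\<close>

lemma thin_line_families:
  assumes s: "0 < s"
    and \<eta>: "(\<epsilon> / \<zeta>) powr s * ((R powr - 2) powr - (\<nu> * s) / (1 - R powr - (\<nu> * s))) \<le> \<eta>"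
  shows "thin_family ({\<theta>} \<times> UNIV) R s \<eta> (\<Union>m. line_family m)"
  unfolding thin_family_def
proof (intro conjI allI ballI impI)
  have "line_family m \<subseteq> (\<lambda>(n, A, B, C). ((\<theta>, crossing A B C), \<epsilon> / Z m n, n)) ` UNIV" for m
  proof
    fix P assume "P \<in> line_family m"
    then obtain n p r q A B C where "P = ((\<theta>, crossing A B C), \<epsilon> / Z m n, n)"
      unfolding line_family_def by blast
    then show "P \<in> range (\<lambda>(n, A, B, C). ((\<theta>, crossing A B C), \<epsilon> / Z m n, n))"
      by (intro range_eqI[of _ _ "(n, A, B, C)"]) simp
  qed
  then have "countable (line_family m)" for m
    by (rule countable_subset) (intro countable_image countableI_type)
  then show "countable (\<Union>m. line_family m)" by blast
  show "case P of (z, r, l) \<Rightarrow> 0 < r" if "P \<in> (\<Union>m. line_family m)" for P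
    using that eps_pos by (auto simp: line_family_def)
next
  fix n and x :: "real \<times> real"
  assume "x \<in> {\<theta>} \<times> UNIV"
    and prem: "\<forall>(z, r, l)\<in>\<Union>m. line_family m. l < n \<longrightarrow> r < dist z x + (1 / R) ^ n"
  then obtain y where x: "x = (\<theta>, y)" by auto
  have dist: "dist (\<theta>, u) (\<theta>, v) = \<bar>u - v\<bar>" for u v :: real
    by (simp add: dist_Pair_Pair dist_real_def)
  have free: "\<epsilon> / Z m' n' < \<bar>crossing A B C - y\<bar> + (1 / R) ^ n"
    if "placed m' n' p r q A B C" "n' < n" for m' n' p r q A B C
  proof -
    have "((\<theta>, crossing A B C), \<epsilon> / Z m' n', n') \<in> (\<Union>m. line_family m)"
      using line_familyI[OF that(1)] by blast
    from bspec[OF prem this] that(2) show ?thesis by (simp add: x dist)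
  qed
  define S where "S m = {(z, r, l) \<in> line_family m. l = n \<and> dist z x \<le> r + (1 / R) ^ n}" for m
  define k where "k = (\<epsilon> / \<zeta>) powr s * ((1 / R) ^ n) powr s"
  define f where "f m = (if R powr - 2 \<le> G m n then G m n powr - (\<nu> * s) else 0)" for m
  have k0: "0 \<le> k" by (simp add: k_def)
  have per_class: "(\<integral>\<^sup>+(z, r, l). ennreal (r powr s) \<partial>count_space (S m)) \<le> ennreal k * ennreal (f m)" for m
  proof (cases "S m = {}")
    case True
    then show ?thesis by (simp add: nn_integral_empty)
  next
    case False
    then obtain p r q A B C where P: "placed m n p r q A B C"
      and y: "\<bar>crossing A B C - y\<bar> \<le> \<epsilon> / Z m n + (1 / R) ^ n"
      unfolding S_def line_family_def by (auto simp: x dist)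
    have "S m \<subseteq> {((\<theta>, crossing A B C), \<epsilon> / Z m n, n)}"
    proof
      fix P' assume "P' \<in> S m"
      then obtain p' r' q' A' B' C' where P': "P' = ((\<theta>, crossing A' B' C'), \<epsilon> / Z m n, n)"
        "placed m n p' r' q' A' B' C'" "\<bar>crossing A' B' C' - y\<bar> \<le> \<epsilon> / Z m n + (1 / R) ^ n"
        unfolding S_def line_family_def by (auto simp: x dist)
      show "P' \<in> {((\<theta>, crossing A B C), \<epsilon> / Z m n, n)}"
      proof -
        have "crossing A' B' C' = crossing A B C"
          by (rule crossing_unique[OF P'(2) P P'(3) y]) (rule free)
        then show ?thesis by (simp add: P'(1))
      qed
    qed
    then have "(\<integral>\<^sup>+(z, r, l). ennreal (r powr s) \<partial>count_space (S m))
        \<le> (\<integral>\<^sup>+(z, r, l). ennreal (r powr s) \<partial>count_space {((\<theta>, crossing A B C), \<epsilon> / Z m n, n)})"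
      by (rule nn_integral_count_space_mono_set)
    also have "\<dots> = ennreal ((\<epsilon> / Z m n) powr s)"
      by (simp add: nn_integral_count_space_finite)
    also have "\<epsilon> / Z m n = \<epsilon> / \<zeta> * (1 / R) ^ n * G m n powr - \<nu>"
      by (simp add: Z_def powr_minus_divide power_divide)
    also have "\<dots> powr s = k * f m"
      by (simp only: powr_mult powr_powr k_def f_def if_True placed_size(1)[OF P] mult_minus_left)
    also have "ennreal (k * f m) = ennreal k * ennreal (f m)"
      using k0 by (intro ennreal_mult) (auto simp: f_def)
    finally show ?thesis .
  qed
  have "(\<integral>\<^sup>+(z, r, l). ennreal (r powr s) \<partial>count_space (\<Union>m. S m)) \<le> (\<Sum>m. ennreal k * ennreal (f m))"
    by (rule order_trans[OF nn_integral_count_space_UN_le]) (intro suminf_le per_class; simp)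
  also have "\<dots> = ennreal k * (\<Sum>m. ennreal (f m))" by simp
  also have "\<dots> \<le> ennreal k * ennreal ((R powr - 2) powr - (\<nu> * s) / (1 - R powr - (\<nu> * s)))"
    unfolding f_def
  proof (intro mult_left_mono geometric_tail_sum_le)
    show "R * G m n \<le> G (Suc m) n" for m
    proof -
      have "R powr 1 \<le> R powr (1 + j)" using R weights by (intro powr_mono) auto
      then have "R * T m powr (1 + j) \<le> R powr (1 + j) * T m powr (1 + j)"
        using R by (intro mult_right_mono) auto
      also have "\<dots> = T (Suc m) powr (1 + j)" by (simp add: T_def powr_mult)
      finally show ?thesis
        unfolding G_def using R \<zeta> by (simp add: divide_right_mono)
    qed
  qed (use R s \<nu> in auto)
  also have "\<dots> = ennreal (k * ((R powr - 2) powr - (\<nu> * s) / (1 - R powr - (\<nu> * s))))"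
    by (rule ennreal_mult'[OF k0, symmetric])
  also have "\<dots> \<le> ennreal (\<eta> * ((1 / R) ^ n) powr s)"
  proof (rule ennreal_leI)
    have "(\<epsilon> / \<zeta>) powr s * ((R powr - 2) powr - (\<nu> * s) / (1 - R powr - (\<nu> * s))) * ((1 / R) ^ n) powr s
        \<le> \<eta> * ((1 / R) ^ n) powr s"
      using \<eta> by (intro mult_right_mono) auto
    then show "k * ((R powr - 2) powr - (\<nu> * s) / (1 - R powr - (\<nu> * s))) \<le> \<eta> * ((1 / R) ^ n) powr s"
      by (simp add: k_def mult_ac)
  qed
  finally have "(\<integral>\<^sup>+(z, r, l). ennreal (r powr s) \<partial>count_space (\<Union>m. S m)) \<le> ennreal (\<eta> * ((1 / R) ^ n) powr s)" .
  moreover have "(\<Union>m. S m) = {(z, r, l) \<in> \<Union>m. line_family m. l = n \<and> dist z x \<le> r + (1 / R) ^ n}"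
    by (auto simp: S_def)
  ultimately show "(\<integral>\<^sup>+(z, r, l). ennreal (r powr s)
       \<partial>count_space {(z, r, l) \<in> \<Union>m. line_family m. l = n \<and> dist z x \<le> r + (1 / R) ^ n})
       \<le> ennreal (\<eta> * ((1 / R) ^ n) powr s)"
    by simp
qed

lemma avoiding_line_families_Bad2:
  assumes avoid: "\<And>m z r l. (z, r, l) \<in> line_family m \<Longrightarrow> r < dist z (\<theta>, y)"
  shows "(\<theta>, y) \<in> Bad2 i j"
proof -
  have "c < max (real q * \<bar>real q * \<theta> - of_int p\<bar> powr (1 / i)) (real q * \<bar>real q * y - of_int r\<bar> powr (1 / j))"
    if q: "1 \<le> q" for p r :: int and q :: nat
  proof (rule ccontr)
    assume "\<not> ?thesis"
    then have le: "real q * \<bar>real q * \<theta> - of_int p\<bar> powr (1 / i) \<le> c" "real q * \<bar>real q * y - of_int r\<bar> powr (1 / j) \<le> c"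
      by auto
    have conv: "real q powr e * \<bar>u\<bar> \<le> c powr e" if "real q * \<bar>u\<bar> powr (1 / e) \<le> c" "0 < e" for u e
    proof -
      have "(real q * \<bar>u\<bar> powr (1 / e)) powr e \<le> c powr e"
        using that by (intro powr_mono2) auto
      then show ?thesis using that by (simp add: powr_mult powr_powr)
    qed
    have "of_int (int q) powr i * \<bar>of_int (int q) * \<theta> - of_int p\<bar> \<le> c powr i"
      and r: "of_int (int q) powr j * \<bar>of_int (int q) * y - of_int r\<bar> \<le> c powr j"
      using conv[OF le(1)] conv[OF le(2)] weights by simp_all
    then obtain m n p' r' q' A B C where P: "placed m n p' r' q' A B C"
      and cov: "\<bar>crossing A B C - y\<bar> \<le> \<epsilon> / Z m n"
      using bad_interval_covered[of "int q" p r] q by (metis of_nat_1 of_nat_le_iff)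
    have "((\<theta>, crossing A B C), \<epsilon> / Z m n, n) \<in> line_family m"
      by (rule line_familyI[OF P])
    from avoid[OF this] cov show False by (simp add: dist_Pair_Pair dist_real_def)
  qed
  then show ?thesis using weights c(1) by (auto simp: Bad2_def)
qed

end

section \<open>Thin families for every pair of weights\<close>

lemma eventually_powr_less:
  fixes a e :: real
  assumes "0 < a" "0 < e"
  shows "\<forall>\<^sub>F c in at_right 0. c powr a < e"
  unfolding eventually_at_right_field
proof (intro exI conjI allI impI)
  show "0 < e powr (1 / a)" using assms by simp
  fix c :: real assume "0 < c" "c < e powr (1 / a)"
  then have "c powr a < (e powr (1 / a)) powr a" using assms by (intro powr_less_mono2) auto
  then show "c powr a < e" using assms by (simp add: powr_powr)
qed

text \<open>
All requirements of \<open>weighted_lines\<close> are met for small \<open>c\<close>. With \<open>D = 12 R\<^sup>4\<close>, the far regime dictates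
\<open>G0 = (D / c) powr (2 / j)\<close>, and the near regime then dictates \<open>\<zeta>\<close> of order \<open>G0 powr - \<nu>\<close>. The choice
\<open>\<nu> = j min(i, j) / 4\<close> makes \<open>\<zeta>\<close> of order \<open>c powr (min(i, j) / 2)\<close>, which dominates \<open>c\<^sup>i + c\<^sup>j\<close>.
\<close>

lemma exists_thin_family_interior:
  assumes weights: "0 < i" "0 < j" "i + j = 1"
    and \<theta>: "\<theta> \<in> Bad1 i" and R: "2 \<le> R" and s: "0 < s" and \<eta>: "0 < \<eta>"
  shows "\<exists>F. thin_family ({\<theta>} \<times> UNIV) R s \<eta> F \<and>
    (\<forall>y. (\<forall>(z, r, l)\<in>F. r < dist z (\<theta>, y)) \<longrightarrow> (\<theta>, y) \<in> Bad2 i j)"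
proof -
  obtain \<kappa> where \<kappa>: "0 < \<kappa>"
    "\<And>(p::int) (q::nat). 1 \<le> q \<Longrightarrow> \<kappa> < real q powr (1 / i) * \<bar>real q * \<theta> - of_int p\<bar>"
    using \<theta> weights by (auto simp: Bad1_def)
  define \<mu> where "\<mu> = min i j"
  have \<mu>: "0 < \<mu>" "\<mu> \<le> i" "\<mu> \<le> j" "\<mu> \<le> 1" using weights by (auto simp: \<mu>_def)
  define \<nu> where "\<nu> = j * \<mu> / 4"
  have \<nu>j: "\<nu> \<le> j / 4" using \<mu> weights by (simp add: \<nu>_def mult_left_le)
  have \<nu>: "0 < \<nu>" "\<nu> \<le> 1 / 4" using \<mu>(1) \<nu>j weights by (simp add: \<nu>_def, linarith)
  define D where "D = 12 * R ^ 4"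
  have "1 \<le> R ^ 4" using R by (intro one_le_power) auto
  then have D: "1 \<le> D" unfolding D_def by linarith
  define K where "K = (R powr - 2) powr - (\<nu> * s) / (1 - R powr - (\<nu> * s))"
  have "R powr - (\<nu> * s) < 1" using R \<nu> s by (intro powr_less_one) auto
  then have K: "0 < K" using R by (simp add: K_def)
  define L where "L = 32 * R ^ 3 * D powr (\<mu> / 2)"
  have L: "0 < L" using R D by (simp add: L_def)
  have "\<forall>\<^sub>F c in at_right 0. 0 < c \<and> c < 1 \<and> c powr i < \<kappa> \<and> c powr i < 1 / (4 * R) \<and>
      c powr (\<mu> / 2) < 1 / (L * R\<^sup>2) \<and> c powr (\<mu> / 2) < (\<eta> / K) powr (1 / s) / L"
    using \<mu> weights \<kappa> R L K \<eta>
    by (intro eventually_conj eventually_powr_less eventually_at_right_less)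
      (auto simp: eventually_at_right_field intro: exI[of _ 1])
  from eventually_happens[OF this] obtain c where c: "0 < c" "c < 1" "c powr i < \<kappa>" "c powr i < 1 / (4 * R)"
    "c powr (\<mu> / 2) < 1 / (L * R\<^sup>2)" "c powr (\<mu> / 2) < (\<eta> / K) powr (1 / s) / L"
    by (auto simp: trivial_limit_at_right_real)
  define \<zeta> where "\<zeta> = (c / D) powr (\<mu> / 2) / (16 * R ^ 3)"
  define G0 where "G0 = (D / c) powr (2 / j)"
  have \<zeta>: "0 < \<zeta>" using c D R by (simp add: \<zeta>_def)
  have cD: "0 < c / D" "c / D \<le> 1" "1 \<le> D / c" using c D by (auto simp: field_simps)
  have R3: "1 \<le> R ^ 3" using R by (simp add: one_le_power)
  have "\<zeta> \<le> 1"
  proof -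
    have "(c / D) powr (\<mu> / 2) \<le> 1" using cD \<mu> by (intro powr_le1) auto
    then have "(c / D) powr (\<mu> / 2) \<le> 1 * (16 * R ^ 3)" using R3 by linarith
    then show ?thesis unfolding \<zeta>_def using R by (subst pos_divide_le_eq) auto
  qed
  have G01: "1 \<le> G0" unfolding G0_def using cD weights by (intro ge_one_powr_ge_zero) auto
  have le_powr: "c \<le> c powr e" if "0 < e" "e \<le> 1" for e
    using powr_mono'[of e 1 c] that c by simp
  have ratio: "(c powr i + c powr j) / \<zeta> \<le> L * c powr (\<mu> / 2)"
  proof -
    have "c powr i + c powr j \<le> c powr \<mu> + c powr \<mu>"
      using \<mu> c by (intro add_mono powr_mono') auto
    also have "\<dots> = 2 * (c powr (\<mu> / 2) * c powr (\<mu> / 2))" by (simp flip: powr_add)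
    also have "\<dots> = L * c powr (\<mu> / 2) * \<zeta>"
      using D R by (simp add: L_def \<zeta>_def powr_divide)
    finally show ?thesis using \<zeta> by (simp add: pos_divide_le_eq)
  qed
  interpret W: weighted_lines i j \<theta> R c \<zeta> \<nu> G0 \<kappa>
  proof
    show "(c powr i + c powr j) * R\<^sup>2 \<le> \<zeta>"
    proof -
      have "L * c powr (\<mu> / 2) \<le> L * (1 / (L * R\<^sup>2))"
        using c(5) L by (intro mult_left_mono) auto
      also have "\<dots> = 1 / R\<^sup>2" using L by simp
      finally have "(c powr i + c powr j) / \<zeta> \<le> 1 / R\<^sup>2"
        using ratio by linarith
      then show ?thesis using \<zeta> R by (simp add: field_simps)
    qed
    show "2 * R * c powr i + 4 * R ^ 3 * \<zeta> * G0 powr \<nu> < 1"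
    proof -
      have "G0 powr \<nu> = (D / c) powr (\<mu> / 2)"
        using weights by (simp add: G0_def powr_powr \<nu>_def)
      then have "\<zeta> * G0 powr \<nu> = (c / D * (D / c)) powr (\<mu> / 2) / (16 * R ^ 3)"
        unfolding powr_mult by (simp add: \<zeta>_def)
      also have "c / D * (D / c) = 1" using c D by simp
      finally have "4 * R ^ 3 * (\<zeta> * G0 powr \<nu>) = 1 / 4" using R by simp
      moreover have "2 * R * c powr i < 1 / 2" using c(4) R by (simp add: field_simps)
      ultimately show ?thesis by (simp add: mult.assoc)
    qed
    fix G assume G: "G0 \<le> G"
    show "8 * R ^ 4 * G powr (2 * \<nu> - 1) \<le> c powr i"
    proof -
      have "8 * R ^ 4 * G powr (2 * \<nu> - 1) \<le> D * G powr - (1 / 2)"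
        using G G01 \<nu> R by (intro mult_mono powr_mono) (auto simp: D_def)
      also have "\<dots> \<le> D * G0 powr - (1 / 2)"
        using G G01 D by (intro mult_left_mono powr_mono2') auto
      also have "\<dots> = D * (c / D) powr (1 / j)"
        by (simp add: G0_def powr_powr powr_minus powr_divide)
      also have "\<dots> \<le> D * (c / D) powr 1"
        using cD D weights by (intro mult_left_mono powr_mono') auto
      also have "\<dots> = c" using c D by simp
      also have "\<dots> \<le> c powr i" using weights by (intro le_powr) auto
      finally show ?thesis .
    qed
    show "12 * R ^ 4 * G powr (\<nu> + (\<nu> - 1) * j) \<le> c powr j"
    proof -
      have "\<nu> * j \<le> j / 4 * 1" using \<nu>j \<nu> weights by (intro mult_mono) auto
      then have "\<nu> + (\<nu> - 1) * j \<le> - (j / 2)" using \<nu>j by (simp add: algebra_simps)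
      then have "12 * R ^ 4 * G powr (\<nu> + (\<nu> - 1) * j) \<le> D * G powr - (j / 2)"
        unfolding D_def using G G01 R by (intro mult_left_mono powr_mono) auto
      also have "\<dots> \<le> D * G0 powr - (j / 2)"
        using G G01 D weights by (intro mult_left_mono powr_mono2') auto
      also have "\<dots> = c"
        using weights c D by (simp add: G0_def powr_powr powr_minus)
      also have "\<dots> \<le> c powr j" using weights by (intro le_powr) auto
      finally show ?thesis .
    qed
  qed (use weights \<kappa> R c \<zeta> \<open>\<zeta> \<le> 1\<close> \<nu> G01 in auto)
  have "(W.\<epsilon> / \<zeta>) powr s * K \<le> \<eta>"
  proof -
    have "(W.\<epsilon> / \<zeta>) powr s \<le> (L * c powr (\<mu> / 2)) powr s"
      using ratio W.eps_pos \<zeta> s by (intro powr_mono2) (auto simp: W.\<epsilon>_def less_imp_le)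
    also have "\<dots> \<le> ((\<eta> / K) powr (1 / s)) powr s"
      using c(6) L s by (intro powr_mono2) (auto simp: field_simps)
    also have "\<dots> = \<eta> / K" using s \<eta> K by (simp add: powr_powr)
    finally show ?thesis using K by (simp add: field_simps)
  qed
  then have "thin_family ({\<theta>} \<times> UNIV) R s \<eta> (\<Union>m. W.line_family m)"
    unfolding K_def by (rule W.thin_line_families[OF s])
  then show ?thesis
    using W.avoiding_line_families_Bad2 by (intro exI[of _ "\<Union>m. W.line_family m"]) fast
qed

text \<open>
For the weights \<open>(0, 1)\<close> rational numbers take the place of lines: distinct fractions with denominators
about \<open>q\<close> are at least about \<open>1 / q\<^sup>2\<close> apart.
\<close>

lemma exists_thin_family_rationals:
  fixes \<theta> :: real
  assumes R: "2 \<le> R" and s: "0 < s" and \<eta>: "0 < \<eta>"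
  shows "\<exists>F. thin_family ({\<theta>} \<times> UNIV) R s \<eta> F \<and>
    (\<forall>y. (\<forall>(z, r, l)\<in>F. r < dist z (\<theta>, y)) \<longrightarrow> y \<in> BA)"
proof -
  define \<zeta> where "\<zeta> = 1 / (4 * R)"
  have \<zeta>: "0 < \<zeta>" "\<zeta> \<le> 1" using R by (auto simp: \<zeta>_def field_simps)
  define k where "k = min 1 (\<eta> powr (1 / s))"
  have k: "0 < k" "k \<le> 1" "k powr s \<le> \<eta>"
  proof -
    show "0 < k" "k \<le> 1" using \<eta> by (auto simp: k_def)
    have "k powr s \<le> (\<eta> powr (1 / s)) powr s"
      using \<open>0 < k\<close> s by (intro powr_mono2) (auto simp: k_def)
    then show "k powr s \<le> \<eta>" using s \<eta> by (simp add: powr_powr)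
  qed
  define F :: "((real \<times> real) \<times> real \<times> nat) set" where
    "F = {((\<theta>, of_int p / real q), k * (1 / R) ^ n, n) | p q n.
        1 \<le> q \<and> \<zeta> * R ^ n \<le> (real q)\<^sup>2 \<and> (real q)\<^sup>2 < \<zeta> * R ^ Suc n}"
  have dist: "dist (\<theta>, u) (\<theta>, v) = \<bar>u - v\<bar>" for u v :: real
    by (simp add: dist_Pair_Pair dist_real_def)
  have "thin_family ({\<theta>} \<times> UNIV) R s \<eta> F"
    unfolding thin_family_def
  proof (intro conjI allI ballI impI)
    have "F \<subseteq> range (\<lambda>(p, q, n). ((\<theta>, of_int p / real q), k * (1 / R) ^ n, n))"
    proof
      fix P assume "P \<in> F"
      then obtain p q n where "P = ((\<theta>, of_int p / real q), k * (1 / R) ^ n, n)"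
        unfolding F_def by blast
      then show "P \<in> range (\<lambda>(p, q, n). ((\<theta>, of_int p / real q), k * (1 / R) ^ n, n))"
        by (intro range_eqI[of _ _ "(p, q, n)"]) simp
    qed
    then show "countable F" by (rule countable_subset) (intro countable_image countableI_type)
    show "case P of (z, r, l) \<Rightarrow> 0 < r" if "P \<in> F" for P
      using that R k by (auto simp: F_def)
    fix n and x :: "real \<times> real"
    assume "x \<in> {\<theta>} \<times> UNIV"
    then obtain y where x: "x = (\<theta>, y)" by auto
    define S where "S = {(z, r, l) \<in> F. l = n \<and> dist z x \<le> r + (1 / R) ^ n}"
    have unique: "P = P'" if PS: "P \<in> S" "P' \<in> S" for P P'
    proof -
      obtain p q where P: "P = ((\<theta>, of_int p / real q), k * (1 / R) ^ n, n)" "1 \<le> q"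
        "(real q)\<^sup>2 < \<zeta> * R ^ Suc n" "\<bar>of_int p / real q - y\<bar> \<le> k * (1 / R) ^ n + (1 / R) ^ n"
        using PS(1) by (auto simp: S_def F_def x dist)
      obtain p' q' where P': "P' = ((\<theta>, of_int p' / real q'), k * (1 / R) ^ n, n)" "1 \<le> q'"
        "(real q')\<^sup>2 < \<zeta> * R ^ Suc n" "\<bar>of_int p' / real q' - y\<bar> \<le> k * (1 / R) ^ n + (1 / R) ^ n"
        using PS(2) by (auto simp: S_def F_def x dist)
      have q: "0 < real q" "0 < real q'" using P(2) P'(2) by auto
      have "p * int q' = p' * int q"
      proof (rule ccontr)
        assume "\<not> ?thesis"
        then have "1 \<le> \<bar>p * int q' - p' * int q\<bar>" by simp
        then have "1 \<le> \<bar>real_of_int (p * int q' - p' * int q)\<bar>" by linarith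
        also have "real_of_int (p * int q' - p' * int q) = real q * real q' * (of_int p / real q - of_int p' / real q')"
          using q by (simp add: field_simps)
        also have "\<bar>\<dots>\<bar> = real q * real q' * \<bar>of_int p / real q - of_int p' / real q'\<bar>"
          using q by (simp add: abs_mult)
        also have "\<dots> \<le> real q * real q' * (2 * (2 * (1 / R) ^ n))"
        proof (intro mult_left_mono)
          have "k * (1 / R) ^ n \<le> 1 * (1 / R) ^ n" using k R by (intro mult_right_mono) auto
          then show "\<bar>of_int p / real q - of_int p' / real q'\<bar> \<le> 2 * (2 * (1 / R) ^ n)"
            using P(4) P'(4) by linarith
        qed (use q in auto)
        also have "\<dots> < \<zeta> * R ^ Suc n * (2 * (2 * (1 / R) ^ n))"
        proof (intro mult_strict_right_mono)
          show "real q * real q' < \<zeta> * R ^ Suc n"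
            using sum_squares_bound[of "real q" "real q'"] P(3) P'(3) by linarith
        qed (use R in auto)
        also have "\<dots> = 1" using R by (simp add: \<zeta>_def power_divide)
        finally show False by simp
      qed
      then have "real_of_int (p * int q') = real_of_int (p' * int q)" by simp
      then show ?thesis using P(1) P'(1) q by (simp add: field_simps)
    qed
    have "(\<integral>\<^sup>+(z, r, l). ennreal (r powr s) \<partial>count_space S) \<le> ennreal (\<eta> * ((1 / R) ^ n) powr s)"
    proof (cases "S = {}")
      case False
      then obtain P where P: "P \<in> S" by auto
      then have S: "S = {P}" using unique[OF _ P] by blast
      obtain z where z: "P = (z, k * (1 / R) ^ n, n)" using P by (auto simp: S_def F_def)
      have "(k * (1 / R) ^ n) powr s \<le> \<eta> * ((1 / R) ^ n) powr s"
        unfolding powr_mult using k by (intro mult_right_mono) auto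
      then show ?thesis
        unfolding S z by (simp add: nn_integral_count_space_finite ennreal_leI)
    qed (simp add: nn_integral_empty)
    then show "(\<integral>\<^sup>+(z, r, l). ennreal (r powr s) \<partial>count_space {(z, r, l) \<in> F. l = n \<and> dist z x \<le> r + (1 / R) ^ n})
        \<le> ennreal (\<eta> * ((1 / R) ^ n) powr s)" by (simp add: S_def)
  qed
  moreover have "y \<in> BA" if avoid: "\<forall>(z, r, l)\<in>F. r < dist z (\<theta>, y)" for y
  proof -
    have "k * \<zeta> < real q * \<bar>real q * y - of_int p\<bar>" if q: "1 \<le> q" for p :: int and q :: nat
    proof -
      have "1 \<le> (real q)\<^sup>2 / \<zeta>"
      proof -
        have "1 \<le> (real q)\<^sup>2" using q by (intro one_le_power) auto
        then have "1 * \<zeta> \<le> (real q)\<^sup>2" using \<zeta>(2) by linarith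
        then show ?thesis using \<zeta>(1) by (simp only: pos_le_divide_eq)
      qed
      then obtain n where "R ^ n \<le> (real q)\<^sup>2 / \<zeta>" "(real q)\<^sup>2 / \<zeta> < R ^ Suc n"
        using exists_power_bracket[of R "(real q)\<^sup>2 / \<zeta>"] R by auto
      then have n: "\<zeta> * R ^ n \<le> (real q)\<^sup>2" "(real q)\<^sup>2 < \<zeta> * R ^ Suc n"
        using \<zeta> by (simp_all only: pos_le_divide_eq pos_divide_less_eq mult.commute)
      then have "((\<theta>, of_int p / real q), k * (1 / R) ^ n, n) \<in> F"
        using q unfolding F_def by blast
      from bspec[OF avoid this] have far: "k * (1 / R) ^ n < \<bar>of_int p / real q - y\<bar>" by (simp add: dist)
      have "k * \<zeta> = k * (1 / R) ^ n * (\<zeta> * R ^ n)" using R by (simp add: power_divide)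
      also have "\<dots> \<le> k * (1 / R) ^ n * (real q)\<^sup>2" using n k R by (intro mult_left_mono) auto
      also have "\<dots> < \<bar>of_int p / real q - y\<bar> * (real q)\<^sup>2"
        using far q by (intro mult_strict_right_mono) auto
      also have "\<dots> = real q * \<bar>real q * (of_int p / real q - y)\<bar>"
        by (simp add: abs_mult power2_eq_square)
      also have "real q * (of_int p / real q - y) = - (real q * y - of_int p)"
        using q by (simp add: field_simps)
      finally show ?thesis by (simp only: abs_minus_cancel)
    qed
    then show ?thesis unfolding BA_def using k \<zeta> by (intro CollectI exI[of _ "k * \<zeta>"]) auto
  qed
  ultimately show ?thesis by blast
qed

lemma Bad1_antimono:
  assumes "0 \<le> i'" "i' \<le> i"
  shows "Bad1 i \<subseteq> Bad1 i'"
proof (cases "i' = 0")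
  case False
  show ?thesis
  proof
    fix x assume "x \<in> Bad1 i"
    then obtain c where c: "0 < c" "\<And>(p::int) (q::nat). 1 \<le> q \<Longrightarrow> c < real q powr (1 / i) * \<bar>real q * x - of_int p\<bar>"
      using False assms by (auto simp: Bad1_def)
    have "c < real q powr (1 / i') * \<bar>real q * x - of_int p\<bar>" if "1 \<le> q" for p :: int and q :: nat
    proof -
      have "real q powr (1 / i) \<le> real q powr (1 / i')"
        using that False assms by (intro powr_mono) (auto simp: frac_le)
      then have "real q powr (1 / i) * \<bar>real q * x - of_int p\<bar> \<le> real q powr (1 / i') * \<bar>real q * x - of_int p\<bar>"
        by (intro mult_right_mono) auto
      then show ?thesis using c(2)[OF that, of p] by linarith
    qed
    then show "x \<in> Bad1 i'" using c(1) False by (auto simp: Bad1_def)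
  qed
qed (simp add: Bad1_def)

lemma Bad1_one: "Bad1 1 = BA"
proof -
  have "real q powr 1 = real q" for q :: nat by simp
  then show ?thesis by (simp add: Bad1_def BA_def)
qed

lemma exists_thin_family_weight:
  assumes "0 \<le> i" "0 \<le> j" "i + j = 1" "\<theta> \<in> Bad1 i" "2 \<le> R" "0 < s" "0 < \<eta>"
  shows "\<exists>F. thin_family ({\<theta>} \<times> UNIV) R s \<eta> F \<and>
    (\<forall>y. (\<forall>(z, r, l)\<in>F. r < dist z (\<theta>, y)) \<longrightarrow> (\<theta>, y) \<in> Bad2 i j)"
proof (cases "j = 0 \<or> i = 0")
  case False
  then show ?thesis using assms by (intro exists_thin_family_interior) auto
next
  case True
  then show ?thesis
  proof
    assume "j = 0"
    then have "(\<theta>, y) \<in> Bad2 i j" for y using assms Bad1_one by (auto simp: Bad2_def)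
    moreover have "thin_family ({\<theta>} \<times> UNIV) R s \<eta> {}"
      by (simp add: thin_family_def nn_integral_empty)
    ultimately show ?thesis by blast
  next
    assume "i = 0"
    then show ?thesis using exists_thin_family_rationals[OF assms(5,6,7), of \<theta>] assms by (auto simp: Bad2_def)
  qed
qed

section \<open>Full dimension\<close>

theorem theorem19:
  fixes i j :: "nat \<Rightarrow> real" and \<theta> :: real
    and C :: "(real \<times> real) set" and M :: "(real \<times> real) measure"
  assumes "\<And>t. i t \<in> {0..1}" and "\<And>t. j t \<in> {0..1}" and "\<And>t. i t + j t = 1"
    and "\<theta> \<in> Bad1 (SUP t. i t)"
    and "power_law M" and "emeasure M (space M) \<noteq> 0"
    and "C = measure_support M"
    and "C \<subseteq> {(\<theta>, y) | y. y \<in> {0..1}}"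
  shows "hausdorff_dim (C \<inter> (\<Inter>t. Bad2 (i t) (j t))) = hausdorff_dim C"
proof (rule antisym)
  let ?E = "C \<inter> (\<Inter>t. Bad2 (i t) (j t))"
  show "hausdorff_dim ?E \<le> hausdorff_dim C" by (intro hausdorff_dim_mono) auto
  obtain \<beta> b1 b2 where sets: "sets M = sets borel" and pos: "0 < \<beta>" "0 < b1" "0 < b2"
    and lower: "\<And>x r. x \<in> C \<Longrightarrow> 0 < r \<Longrightarrow> r < 1 \<Longrightarrow> ennreal (b1 * r powr \<beta>) \<le> emeasure M (ball x r)"
    and upper: "\<And>x r. x \<in> C \<Longrightarrow> 0 < r \<Longrightarrow> r < 1 \<Longrightarrow> emeasure M (ball x r) \<le> ennreal (b2 * r powr \<beta>)"
    using assms(5) unfolding power_law_def assms(7) by blast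
  have C_closed: "closed C" unfolding assms(7) by (rule closed_measure_support)
  have null: "emeasure M (- C) = 0"
    unfolding assms(7) by (rule emeasure_compl_measure_support[OF sets])
  have space: "space M = UNIV" using sets_eq_imp_space_eq[OF sets] by simp
  have C_ne: "C \<noteq> {}" using null assms(6) space by auto
  have C_fibre: "C \<subseteq> {\<theta>} \<times> {0..1}" using assms(8) by auto
  have fin: "emeasure M UNIV < \<infinity>"
  proof -
    have "compact ({\<theta>} \<times> {0..1::real})" by (intro compact_Times) auto
    then have "compact C" using C_closed C_fibre by (metis compact_Int_closed inf.absorb_iff2)
    then obtain A where A: "A \<subseteq> C" "finite A" "C \<subseteq> (\<Union>x\<in>A. ball x (1/2))"
      by (rule compactE_image[of C C "\<lambda>x. ball x (1/2)"]) auto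
    have opens: "open (- C)" "open (\<Union>x\<in>A. ball x (1/2))" using C_closed by auto
    have "emeasure M UNIV \<le> emeasure M (- C \<union> (\<Union>x\<in>A. ball x (1/2)))"
      using A opens by (intro emeasure_mono) (auto simp: sets intro!: borel_open)
    also have "\<dots> \<le> emeasure M (- C) + emeasure M (\<Union>x\<in>A. ball x (1/2))"
      using opens by (intro emeasure_subadditive) (auto simp: sets intro!: borel_open)
    also have "\<dots> \<le> 0 + (\<Sum>x\<in>A. emeasure M (ball x (1/2)))"
      unfolding null using A sets by (intro add_left_mono emeasure_subadditive_finite) auto
    also have "\<dots> \<le> 0 + (\<Sum>x\<in>A. ennreal (b2 * (1/2) powr \<beta>))"
      using A(1) by (intro add_left_mono sum_mono upper) auto
    also have "\<dots> < \<infinity>"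
      using pos by (simp add: sum_ennreal del: sum_constant)
    finally show ?thesis .
  qed
  have "hausdorff_dim C \<le> ennreal \<beta>"
  proof (rule ennreal_le_epsilon)
    fix e :: real assume "0 < e"
    then have "hausdorff_measure (\<beta> + e) C = 0"
      using lower by (intro power_law_upper_dimension[OF sets fin pos(2,1)]) auto
    then have "hausdorff_dim C \<le> ennreal (\<beta> + e)"
      unfolding hausdorff_dim_def using pos \<open>0 < e\<close>
      by (intro Inf_lower CollectI exI[of _ "\<beta> + e"]) simp
    then show "hausdorff_dim C \<le> ennreal \<beta> + ennreal e" using pos \<open>0 < e\<close> by simp
  qed
  also have "ennreal \<beta> \<le> hausdorff_dim ?E"
    unfolding hausdorff_dim_def
  proof (rule Inf_greatest, clarify, rule ennreal_leI, rule ccontr)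
    fix s assume s: "0 \<le> s" "hausdorff_measure s ?E = 0" "\<not> \<beta> \<le> s"
    define s' where "s' = (s + \<beta>) / 2"
    have s': "0 < s'" "s < s'" "s' < \<beta>" using s by (auto simp: s'_def)
    define R where "R = max 6 ((2 * 10 powr \<beta> * b2 / b1 + 1) powr (1 / (\<beta> - s')))"
    have R: "6 \<le> R" by (simp add: R_def)
    have R_large: "2 * 10 powr \<beta> * b2 < b1 * R powr (\<beta> - s')"
    proof -
      have "2 * 10 powr \<beta> * b2 / b1 < ((2 * 10 powr \<beta> * b2 / b1 + 1) powr (1 / (\<beta> - s'))) powr (\<beta> - s')"
        using pos s' by (simp add: powr_powr add_nonneg_pos)
      also have "\<dots> \<le> R powr (\<beta> - s')"
        using s' by (intro powr_mono2) (auto simp: R_def)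
      finally show ?thesis using pos by (simp add: field_simps)
    qed
    define \<eta> where "\<eta> = R powr - s' / 2"
    have \<eta>: "0 < \<eta>" "2 * \<eta> \<le> R powr - s'" using R by (auto simp: \<eta>_def)
    have "0 < \<eta> / 2" using \<eta> by simp
    then obtain z r where cover: "\<And>n::nat. 0 < r n" "?E \<subseteq> (\<Union>n. cball (z n) (r n))"
      "(\<Sum>n. ennreal (r n powr s')) \<le> ennreal (\<eta> / 2)"
      by (rule hausdorff_null_ball_cover[OF s(2,1) s'(2)]) (rule that, blast, assumption+)
    have \<theta>: "\<theta> \<in> Bad1 (i t)" for t
    proof -
      have "bdd_above (range i)" using assms(1) by (intro bdd_aboveI[of _ 1]) auto
      then have "i t \<le> (SUP t. i t)" by (intro cSUP_upper) auto
      then show ?thesis using Bad1_antimono[of "i t" "SUP t. i t"] assms(1)[of t] assms(4) by auto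
    qed
    have "\<exists>F. thin_family ({\<theta>} \<times> UNIV) R s' (\<eta> * (1/2) ^ Suc (Suc t)) F \<and>
      (\<forall>y. (\<forall>(z, r, l)\<in>F. r < dist z (\<theta>, y)) \<longrightarrow> (\<theta>, y) \<in> Bad2 (i t) (j t))" for t
      using assms(1,2)[of t] assms(3) \<theta> R s' \<eta> by (intro exists_thin_family_weight) auto
    then obtain F where F: "\<And>t. thin_family ({\<theta>} \<times> UNIV) R s' (\<eta> * (1/2) ^ Suc (Suc t)) (F t)"
      "\<And>t y. (\<forall>(z, r, l)\<in>F t. r < dist z (\<theta>, y)) \<Longrightarrow> (\<theta>, y) \<in> Bad2 (i t) (j t)"
      by metis
    define H where "H = case_nat (range (\<lambda>n. (z n, r n, 0))) F"
    have H: "H 0 = range (\<lambda>n. (z n, r n, 0))" "H (Suc t) = F t" for t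
      by (simp_all add: H_def)
    have thin: "thin_family ({\<theta>} \<times> UNIV) R s' \<eta> (\<Union>t. H t)"
    proof (rule thin_family_UN)
      fix t
      show "thin_family ({\<theta>} \<times> UNIV) R s' (\<eta> * (1/2) ^ Suc t) (H t)"
      proof (cases t)
        case 0
        have half: "\<eta> * (1/2) ^ Suc 0 = \<eta> / 2" by simp
        show ?thesis
          unfolding 0 half H by (rule thin_family_level_zero[OF cover(1,3)])
      next
        case (Suc u)
        show ?thesis unfolding Suc H by (rule F(1))
      qed
    qed (use \<eta> in simp)
    have "C \<subseteq> {\<theta>} \<times> UNIV" using C_fibre by auto
    then have "\<exists>x\<in>C. \<forall>(z, r, l)\<in>\<Union>t. H t. r < dist z x"
      by (rule exists_point_avoiding_thin_family[OF sets C_closed C_ne _ null pos(2,3) s'(1) pos(1)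
          lower upper R R_large \<eta> thin])
    then obtain x where x: "x \<in> C" and avoid: "\<forall>P\<in>\<Union>t. H t. case P of (z, r, l) \<Rightarrow> r < dist z x"
      by blast
    obtain y where y: "x = (\<theta>, y)" using x C_fibre by auto
    have "x \<in> Bad2 (i t) (j t)" for t
    proof -
      have "\<forall>(z, r, l)\<in>F t. r < dist z (\<theta>, y)"
      proof
        fix P assume "P \<in> F t"
        then have "P \<in> (\<Union>t. H t)" using H(2) by blast
        from bspec[OF avoid this] show "case P of (z, r, l) \<Rightarrow> r < dist z (\<theta>, y)" unfolding y .
      qed
      then show ?thesis unfolding y by (rule F(2))
    qed
    then have "x \<in> ?E" using x by blast
    then obtain n where "x \<in> cball (z n) (r n)" using cover(2) by blast
    then have "dist (z n) x \<le> r n" by simp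
    moreover have "r n < dist (z n) x"
    proof -
      have "(z n, r n, 0) \<in> (\<Union>t. H t)" using H(1) by blast
      from bspec[OF avoid this] show ?thesis by simp
    qed
    ultimately show False by simp
  qed
  finally show "hausdorff_dim C \<le> hausdorff_dim ?E" .
qed

end
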